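(* Let $\tau>0$ and let $P \subseteq \mathbb{R}^n$ be a pointed, full-dimensional polyhedron all of whose vertex (outer) normal cones are $\tau$-wide. Then the graph ($1$-skeleton) of $P$ has diameter at most $\frac{8n}{\tau}\left(1+\ln \frac{1}{\tau}\right)$; that is, any two vertices of $P$ are joined by a path of at most this many edges of $P$.
   Context: For a polyhedron $P=\{x\in\mathbb{R}^n : Ax\le b\}$ with rows $a_1,\dots,a_m$ of $A$, and a vertex $v$ of $P$, the (outer) normal cone of $v$ is $N_v=\{\sum_{i\in I_v}\lambda_i a_i : \lambda_i\ge 0\}$, where $I_v=\{i : \langle a_i,v\rangle=b_i\}$; equivalently, the set of objectives $c$ whose maximum over $P$ is attained at $v$. A cone $C\subseteq\mathbb{R}^n$ is $\tau$-wide if it contains a Euclidean ball of radius $\tau$ whose center lies on the unit sphere $\mathbb{S}^{n-1}$. *)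

theory Defs
  imports "HOL-Analysis.Analysis" "Graph_Theory.Shortest_Path"
begin

definition polyhedron_of :: "real^'n^'m \<Rightarrow> real^'m \<Rightarrow> (real^'n) set" where
  "polyhedron_of A b = {x. \<forall>i. row i A \<bullet> x \<le> b $ i}"

definition active_rows :: "real^'n^'m \<Rightarrow> real^'m \<Rightarrow> real^'n \<Rightarrow> 'm set" where
  "active_rows A b v = {i. row i A \<bullet> v = b $ i}"

definition normal_cone :: "real^'n^'m \<Rightarrow> real^'m \<Rightarrow> real^'n \<Rightarrow> (real^'n) set" where
  "normal_cone A b v =
     {(\<Sum>i\<in>active_rows A b v. l i *\<^sub>R row i A) | l. \<forall>i\<in>active_rows A b v. l i \<ge> 0}"

text \<open>The ball is taken closed; for a closed set \<open>C\<close>, in particular a normal cone, the open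
  ball gives the same notion.\<close>

definition wide :: "real \<Rightarrow> 'a::euclidean_space set \<Rightarrow> bool" where
  "wide \<tau> C \<longleftrightarrow> (\<exists>c\<in>sphere 0 1. cball c \<tau> \<subseteq> C)"

definition contains_line :: "'a::real_vector set \<Rightarrow> bool" where
  "contains_line P \<longleftrightarrow> (\<exists>x d. d \<noteq> 0 \<and> (\<forall>t. x + t *\<^sub>R d \<in> P))"

definition pointed :: "'a::real_vector set \<Rightarrow> bool" where
  "pointed P \<longleftrightarrow> \<not> contains_line P"

definition full_dimensional :: "'a::euclidean_space set \<Rightarrow> bool" where
  "full_dimensional P \<longleftrightarrow> aff_dim P = int DIM('a)"

text \<open>The undirected 1-skeleton, with each bounded edge of \<open>P\<close> represented by its two orientations.
  There are no loops, since \<open>edge_of\<close> requires affine dimension 1. Unbounded edges (rays)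
  do not join two vertices and contribute no arcs.\<close>

definition skeleton :: "'a::euclidean_space set \<Rightarrow> ('a, 'a \<times> 'a) pre_digraph" where
  "skeleton P =
     \<lparr> verts = {v. v extreme_point_of P},
       arcs = {(u, v). u extreme_point_of P \<and> v extreme_point_of P \<and> closed_segment u v edge_of P},
       tail = fst, head = snd \<rparr>"

lemma wf_digraph_skeleton: "wf_digraph (skeleton P)"
  by unfold_locales (auto simp: skeleton_def)

lemma symmetric_skeleton: "symmetric (skeleton P)"
  by (auto simp: symmetric_def arcs_ends_def arc_to_ends_def skeleton_def sym_def
      closed_segment_commute image_iff)

text \<open>With unit weights, \<open>\<mu>\<close> is the graph distance, infinite for disconnected pairs.\<close>

definition graph_diameter :: "('a, 'b) pre_digraph \<Rightarrow> ereal" where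
  "graph_diameter G = (SUP u\<in>verts G. SUP v\<in>verts G. wf_digraph.\<mu> G (\<lambda>_. 1) u v)"

end

theory Submission
  imports Defs
begin

text \<open>Let \<open>x\<close> be uniformly distributed in the intersection of the unit ball with the cone of all
  objectives that are bounded on \<open>P\<close>, let \<open>w u\<close> and \<open>w v\<close> be the centres of wide balls in the cones
  of two vertices, and move the objective \<open>x + g\<close> along the curve in which \<open>g\<close> shrinks from
  \<open>exp L *\<^sub>R w u\<close> to \<open>w u\<close>, goes straight to \<open>w v\<close> and grows to \<open>exp L *\<^sub>R w v\<close>. If \<open>exp L * \<tau> \<ge> 1\<close> the
  end points lie in the cones of \<open>u\<close> and \<open>v\<close>, and for almost every \<open>x\<close> the optimal vertices along the
  curve form a walk in the graph of \<open>P\<close>. It remains to bound the expected number of times that the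
  optimal vertex changes. In a small time step, the objective stays in the cone of \<open>v\<close> if it is first
  translated by a vector \<open>s *\<^sub>R w v\<close> with \<open>s\<close> of the order of the step size divided by \<open>\<tau>\<close>. Hence the
  volume of those \<open>x\<close> that change cones is at most what the domain gains when its radius grows from
  \<open>1\<close> to \<open>1 + s\<close>, a fraction of \<open>(1 + s) ^ n - 1\<close>. Summing over the steps and refining them, with
  Fatou's lemma in the limit, bounds the expected number of changes by a multiple of \<open>n / \<tau>\<close> times
  the length of the curve, where the two radial pieces count with their logarithmic length \<open>L\<close>.\<close>

subsection \<open>Optimality cones and faces\<close>

text \<open>This is the description of the normal cone by optimality. As an intersection of closed
  halfspaces through the origin, it makes convexity and closedness immediate.\<close>

definition opt_cone :: "'a::real_inner set \<Rightarrow> 'a \<Rightarrow> 'a set" where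
  "opt_cone P v = {y. \<forall>x\<in>P. y \<bullet> x \<le> y \<bullet> v}"

lemma opt_cone_add: "y \<in> opt_cone P v \<Longrightarrow> z \<in> opt_cone P v \<Longrightarrow> y + z \<in> opt_cone P v"
  by (auto simp: opt_cone_def inner_add_left add_mono)

lemma opt_cone_scaleR: "y \<in> opt_cone P v \<Longrightarrow> 0 \<le> t \<Longrightarrow> t *\<^sub>R y \<in> opt_cone P v"
  by (auto simp: opt_cone_def mult_left_mono)

lemma closed_opt_cone: "closed (opt_cone P v)"
proof -
  have "opt_cone P v = (\<Inter>x\<in>P. {y. (x - v) \<bullet> y \<le> 0})"
    by (auto simp: opt_cone_def inner_diff_left inner_diff_right inner_commute)
  then show ?thesis
    by (simp add: closed_INT closed_halfspace_le)
qed

text \<open>The easy half of linear programming duality: no feasible point beats \<open>v\<close> on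
  a row active at \<open>v\<close>. It carries the wide balls over from the generated cones to the
  optimality cones.\<close>

lemma normal_cone_subset_opt_cone:
  "normal_cone A b v \<subseteq> opt_cone (polyhedron_of A b) v"
proof
  fix y assume "y \<in> normal_cone A b v"
  then obtain l where y: "y = (\<Sum>i\<in>active_rows A b v. l i *\<^sub>R row i A)"
    and l: "\<And>i. i \<in> active_rows A b v \<Longrightarrow> l i \<ge> 0"
    by (auto simp: normal_cone_def)
  have "y \<bullet> x \<le> y \<bullet> v" if "x \<in> polyhedron_of A b" for x
    unfolding y inner_sum_left
  proof (rule sum_mono)
    fix i assume i: "i \<in> active_rows A b v"
    then have "row i A \<bullet> x \<le> row i A \<bullet> v"
      using that by (auto simp: polyhedron_of_def active_rows_def)
    then show "(l i *\<^sub>R row i A) \<bullet> x \<le> (l i *\<^sub>R row i A) \<bullet> v"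
      using l[OF i] by (simp add: mult_left_mono)
  qed
  then show "y \<in> opt_cone (polyhedron_of A b) v"
    by (simp add: opt_cone_def)
qed

section \<open>Bounded objectives attain their maximum at a vertex\<close>

lemma polyhedron_polyhedron_of: "polyhedron (polyhedron_of A b)"
proof -
  have "polyhedron_of A b = (\<Inter>i. {x. row i A \<bullet> x \<le> b $ i})"
    by (auto simp: polyhedron_of_def)
  then show ?thesis
    by (auto intro!: polyhedron_Inter polyhedron_halfspace_le)
qed

text \<open>If \<open>x\<close> lies strictly inside a feasible segment, every row active at
  \<open>x\<close> is tight at both ends of the segment. The difference of the ends is then in the
  common kernel of these rows, which \<open>span\<close> makes trivial.\<close>

lemma extreme_point_polyhedron_ofI:
  assumes x: "x \<in> polyhedron_of A b"
    and span: "\<And>d. (\<And>i. i \<in> active_rows A b x \<Longrightarrow> row i A \<bullet> d = 0) \<Longrightarrow> d = 0"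
  shows "x extreme_point_of polyhedron_of A b"
  unfolding extreme_point_of_def
proof (intro conjI ballI notI)
  fix p q assume p: "p \<in> polyhedron_of A b" and q: "q \<in> polyhedron_of A b"
    and xpq: "x \<in> open_segment p q"
  then obtain t where t: "0 < t" "t < 1" "x = (1 - t) *\<^sub>R p + t *\<^sub>R q" and "p \<noteq> q"
    by (auto simp: in_segment)
  have "q - p = 0"
  proof (rule span)
    fix i assume "i \<in> active_rows A b x"
    then have "(1 - t) * (row i A \<bullet> p) + t * (row i A \<bullet> q) = b $ i"
      using t by (simp add: active_rows_def inner_add_right)
    moreover have *: "row i A \<bullet> p \<le> b $ i" "row i A \<bullet> q \<le> b $ i"
      using p q by (auto simp: polyhedron_of_def)
    ultimately have "(1 - t) * (b $ i - row i A \<bullet> p) + t * (b $ i - row i A \<bullet> q) = 0"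
      by (simp add: algebra_simps)
    with * t have "(1 - t) * (b $ i - row i A \<bullet> p) = 0" "t * (b $ i - row i A \<bullet> q) = 0"
      using mult_nonneg_nonneg[of "1-t" "b $ i - row i A \<bullet> p"]
        mult_nonneg_nonneg[of t "b $ i - row i A \<bullet> q"] by linarith+
    with t show "row i A \<bullet> (q - p) = 0"
      by (simp add: inner_diff_right)
  qed
  with \<open>p \<noteq> q\<close> show False by simp
qed (use x in auto)

text \<open>The ratio test of the simplex method: along \<open>d\<close> the active rows stay tight,
  and the move ends when the first further row becomes tight. The infeasible point
  \<open>x + t *\<^sub>R d\<close> guarantees that such a row exists.\<close>

lemma ratio_test:
  assumes x: "x \<in> polyhedron_of A b"
    and d: "\<And>i. i \<in> active_rows A b x \<Longrightarrow> row i A \<bullet> d = 0"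
    and t: "0 < t" "x + t *\<^sub>R d \<notin> polyhedron_of A b"
  obtains s where "0 \<le> s" "x + s *\<^sub>R d \<in> polyhedron_of A b"
    "active_rows A b x \<subset> active_rows A b (x + s *\<^sub>R d)"
proof -
  define I where "I = {i. 0 < row i A \<bullet> d}"
  define r where "r i = (b $ i - row i A \<bullet> x) / (row i A \<bullet> d)" for i
  have xle: "row i A \<bullet> x \<le> b $ i" for i
    using x by (simp add: polyhedron_of_def)
  have "I \<noteq> {}"
  proof
    assume "I = {}"
    then have "row i A \<bullet> d \<le> 0" for i unfolding I_def by (metis (mono_tags) empty_iff mem_Collect_eq not_less)
    then have "t * (row i A \<bullet> d) \<le> 0" for i using t(1) by (simp add: mult_nonneg_nonpos)
    then have "x + t *\<^sub>R d \<in> polyhedron_of A b"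
      using xle by (auto simp: polyhedron_of_def inner_add_right intro: add_decreasing2)
    with t show False by simp
  qed
  define s where "s = Min (r ` I)"
  have fin: "finite (r ` I)" "r ` I \<noteq> {}" using \<open>I \<noteq> {}\<close> by auto
  then have "s \<in> r ` I" unfolding s_def by (rule Min_in)
  then obtain k where k: "k \<in> I" "s = r k" by auto
  have sle: "s \<le> r i" if "i \<in> I" for i
    using fin that by (simp add: s_def)
  have s0: "0 \<le> s" using k xle[of k] by (simp add: r_def I_def)
  have "row i A \<bullet> (x + s *\<^sub>R d) \<le> b $ i" for i
  proof (cases "i \<in> I")
    case True
    then show ?thesis
      using sle[OF True] by (simp add: r_def I_def field_simps inner_add_right)
  next
    case False
    then have "s * (row i A \<bullet> d) \<le> 0" using s0 by (simp add: I_def mult_nonneg_nonpos)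
    then show ?thesis using xle[of i] by (simp add: inner_add_right)
  qed
  then have in_P: "x + s *\<^sub>R d \<in> polyhedron_of A b" by (simp add: polyhedron_of_def)
  have "active_rows A b x \<subseteq> active_rows A b (x + s *\<^sub>R d)"
    using d by (auto simp: active_rows_def inner_add_right)
  moreover have "k \<notin> active_rows A b x"
    using d[of k] k by (auto simp: I_def)
  moreover have "k \<in> active_rows A b (x + s *\<^sub>R d)"
    using k by (simp add: active_rows_def r_def I_def inner_add_right)
  ultimately show thesis using that[OF s0 in_P] by blast
qed

text \<open>Induction on the number of inactive rows. While the active rows have a common kernel, a
  feasible move inside it that does not lower \<open>y\<close> activates a further row; once the
  kernel is trivial, the point is a vertex.\<close>

lemma dominated_by_extreme_point:
  fixes A :: "real^'n^'m"
  assumes "pointed (polyhedron_of A b)" "bdd_above ((\<bullet>) y ` polyhedron_of A b)"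
    and "x \<in> polyhedron_of A b"
  shows "\<exists>v. v extreme_point_of polyhedron_of A b \<and> y \<bullet> x \<le> y \<bullet> v"
  using assms(3)
proof (induction "CARD('m) - card (active_rows A b x)" arbitrary: x rule: less_induct)
  case less
  let ?P = "polyhedron_of A b"
  show ?case
  proof (cases "\<forall>d. (\<forall>i\<in>active_rows A b x. row i A \<bullet> d = 0) \<longrightarrow> d = 0")
    case True
    then have "x extreme_point_of ?P"
      by (intro extreme_point_polyhedron_ofI less.prems) blast
    then show ?thesis by blast
  next
    case False
    then obtain d0 where "d0 \<noteq> 0" and d0: "\<And>i. i \<in> active_rows A b x \<Longrightarrow> row i A \<bullet> d0 = 0"
      by blast
    define d where "d = (if 0 \<le> y \<bullet> d0 then d0 else - d0)"
    have "d \<noteq> 0" and d: "\<And>i. i \<in> active_rows A b x \<Longrightarrow> row i A \<bullet> d = 0" and yd: "0 \<le> y \<bullet> d"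
      using \<open>d0 \<noteq> 0\<close> d0 by (auto simp: d_def)
    \<comment> \<open>If the whole ray along \<open>d\<close> is feasible, boundedness forces
      \<open>y \<bullet> d = 0\<close>. The polyhedron contains no line, so the opposite ray leaves
      it, and that direction does not lower \<open>y\<close> either.\<close>
    have "\<exists>e t. 0 < t \<and> x + t *\<^sub>R e \<notin> ?P \<and> 0 \<le> y \<bullet> e \<and> (\<forall>i \<in> active_rows A b x. row i A \<bullet> e = 0)"
    proof (cases "\<exists>t>0. x + t *\<^sub>R d \<notin> ?P")
      case True
      with d yd show ?thesis by blast
    next
      case ray: False
      obtain B where B: "\<And>z. z \<in> ?P \<Longrightarrow> y \<bullet> z \<le> B"
        using assms(2) by (auto simp: bdd_above_def)
      have "y \<bullet> d = 0"
      proof (rule ccontr)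
        assume "y \<bullet> d \<noteq> 0"
        with yd have pos: "0 < y \<bullet> d" by simp
        define t where "t = (\<bar>B - y \<bullet> x\<bar> + 1) / (y \<bullet> d)"
        have "t > 0" using pos by (simp add: t_def)
        with ray have "y \<bullet> (x + t *\<^sub>R d) \<le> B" by (intro B) auto
        moreover have "t * (y \<bullet> d) = \<bar>B - y \<bullet> x\<bar> + 1" using pos by (simp add: t_def)
        ultimately show False by (simp add: inner_add_right)
      qed
      moreover obtain t where t: "x + t *\<^sub>R d \<notin> ?P"
        using assms(1) \<open>d \<noteq> 0\<close> unfolding pointed_def contains_line_def by blast
      moreover have "t < 0"
        using t ray less.prems by (cases t "0::real" rule: linorder_cases) auto
      ultimately show ?thesis
        using d by (intro exI[of _ "- d"] exI[of _ "- t"]) auto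
    qed
    then obtain e t where e: "0 < t" "x + t *\<^sub>R e \<notin> ?P" "0 \<le> y \<bullet> e"
      "\<And>i. i \<in> active_rows A b x \<Longrightarrow> row i A \<bullet> e = 0" by blast
    obtain s where s: "0 \<le> s" "x + s *\<^sub>R e \<in> ?P"
      "active_rows A b x \<subset> active_rows A b (x + s *\<^sub>R e)"
      using ratio_test[OF less.prems e(4,1,2)] by blast
    have "card (active_rows A b x) < card (active_rows A b (x + s *\<^sub>R e))"
      using s(3) by (intro psubset_card_mono) auto
    moreover have "card (active_rows A b (x + s *\<^sub>R e)) \<le> CARD('m)"
      by (intro card_mono) auto
    ultimately have "CARD('m) - card (active_rows A b (x + s *\<^sub>R e)) < CARD('m) - card (active_rows A b x)"
      by linarith
    from less.hyps[OF this s(2)] obtain v where "v extreme_point_of ?P" "y \<bullet> (x + s *\<^sub>R e) \<le> y \<bullet> v"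
      by blast
    moreover have "0 \<le> s * (y \<bullet> e)" using s e by simp
    ultimately show ?thesis by (intro exI[of _ v]) (simp add: inner_add_right)
  qed
qed

lemma bdd_above_imp_opt_cone:
  fixes A :: "real^'n^'m"
  assumes "pointed (polyhedron_of A b)" "polyhedron_of A b \<noteq> {}"
    and "bdd_above ((\<bullet>) y ` polyhedron_of A b)"
  shows "\<exists>v. v extreme_point_of polyhedron_of A b \<and> y \<in> opt_cone (polyhedron_of A b) v"
proof -
  let ?V = "{v. v extreme_point_of polyhedron_of A b}"
  have fin: "finite ?V"
    by (intro finite_polyhedron_extreme_points polyhedron_polyhedron_of)
  have ne: "?V \<noteq> {}"
    using dominated_by_extreme_point[OF assms(1,3)] assms(2) by blast
  have "Max ((\<bullet>) y ` ?V) \<in> (\<bullet>) y ` ?V"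
    using fin ne by (intro Max_in) auto
  then obtain v where v: "v \<in> ?V" and "Max ((\<bullet>) y ` ?V) = y \<bullet> v" by auto
  then have v_max: "y \<bullet> w \<le> y \<bullet> v" if "w \<in> ?V" for w
    using Max_ge[of "(\<bullet>) y ` ?V" "y \<bullet> w"] fin that by simp
  have "y \<bullet> x \<le> y \<bullet> v" if "x \<in> polyhedron_of A b" for x
    using dominated_by_extreme_point[OF assms(1,3) that] v_max by force
  with v show ?thesis by (auto simp: opt_cone_def)
qed

text \<open>The differences of points of \<open>F\<close> span at least two dimensions, so some
  nonzero combination \<open>e\<close> of them is orthogonal to \<open>h\<close>. An objective that
  is constant on \<open>F\<close> is orthogonal to all differences, hence to \<open>e\<close>, and
  this condition is unaffected by adding multiples of \<open>h\<close>.\<close>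

lemma not_collinear_orthogonal:
  fixes F :: "'a::euclidean_space set"
  assumes "\<not> collinear F"
  obtains e where "e \<noteq> 0" "h \<bullet> e = 0"
    "\<And>y. (\<And>a b. a \<in> F \<Longrightarrow> b \<in> F \<Longrightarrow> y \<bullet> a = y \<bullet> b) \<Longrightarrow> y \<bullet> e = 0"
proof -
  obtain a b where ab: "a \<in> F" "b \<in> F" "a \<noteq> b"
  proof -
    have "\<exists>a\<in>F. \<exists>b\<in>F. a - b \<noteq> 0 *\<^sub>R 0"
      using assms unfolding collinear_def by blast
    with that show thesis by auto
  qed
  show thesis
  proof (cases "h \<bullet> (b - a) = 0")
    case True
    show thesis
    proof (rule that)
      show "b - a \<noteq> 0" using ab by simp
      show "h \<bullet> (b - a) = 0" by (rule True)
      show "y \<bullet> (b - a) = 0" if "\<And>a b. a \<in> F \<Longrightarrow> b \<in> F \<Longrightarrow> y \<bullet> a = y \<bullet> b" for y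
        using that[OF ab(1,2)] by (simp add: inner_diff_right)
    qed
  next
    case False
    obtain p q where pq: "p \<in> F" "q \<in> F" "\<And>c. p - q \<noteq> c *\<^sub>R (b - a)"
      using assms unfolding collinear_def by blast
    \<comment> \<open>A combination of two independent differences whose products with
      \<open>h\<close> cancel.\<close>
    define e where "e = (h \<bullet> (b - a)) *\<^sub>R (p - q) - (h \<bullet> (p - q)) *\<^sub>R (b - a)"
    have "e \<noteq> 0"
    proof
      assume "e = 0"
      then have *: "(h \<bullet> (b - a)) *\<^sub>R (p - q) = (h \<bullet> (p - q)) *\<^sub>R (b - a)"
        by (simp add: e_def)
      have "p - q = inverse (h \<bullet> (b - a)) *\<^sub>R ((h \<bullet> (b - a)) *\<^sub>R (p - q))"
        using False by simp
      also have "\<dots> = (inverse (h \<bullet> (b - a)) * (h \<bullet> (p - q))) *\<^sub>R (b - a)"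
        unfolding * by simp
      finally show False using pq(3) by blast
    qed
    moreover have "h \<bullet> e = 0" by (simp add: e_def inner_diff_right algebra_simps)
    moreover have "y \<bullet> e = 0" if "\<And>a b. a \<in> F \<Longrightarrow> b \<in> F \<Longrightarrow> y \<bullet> a = y \<bullet> b" for y
      using that[OF ab(1,2)] that[OF pq(1,2)] by (simp add: e_def inner_diff_right)
    ultimately show thesis using that by blast
  qed
qed

text \<open>A point of \<open>F\<close> outside the segment, but on the line through
  \<open>u\<close> and \<open>v\<close>, would put \<open>u\<close> or \<open>v\<close> strictly
  between two points of \<open>P\<close>.\<close>

lemma collinear_face_closed_segment:
  assumes F: "F face_of P" and "collinear F"
    and u: "u extreme_point_of P" "u \<in> F" and v: "v extreme_point_of P" "v \<in> F" and "u \<noteq> v"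
  shows "closed_segment u v edge_of P"
proof -
  have "F = closed_segment u v"
  proof
    show "closed_segment u v \<subseteq> F"
      using u v F by (meson closed_segment_subset face_of_imp_convex)
    show "F \<subseteq> closed_segment u v"
    proof
      fix x assume x: "x \<in> F"
      have "collinear {u, v, x}"
        using u v x \<open>collinear F\<close> by (blast intro: collinear_subset)
      then consider "u \<in> closed_segment v x" | "v \<in> closed_segment x u" | "x \<in> closed_segment u v"
        unfolding collinear_between_cases between_mem_segment by blast
      moreover have "x \<in> P" "u \<in> P" "v \<in> P"
        using F x u v face_of_imp_subset by blast+
      moreover have "u \<notin> open_segment v x" "v \<notin> open_segment x u"
        using u v \<open>x \<in> P\<close> \<open>u \<in> P\<close> \<open>v \<in> P\<close> by (auto simp: extreme_point_of_def)
      ultimately show "x \<in> closed_segment u v"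
        using \<open>u \<noteq> v\<close> by (cases; auto simp: open_segment_def)
    qed
  qed
  moreover have "aff_dim (closed_segment u v) = 1"
    using \<open>u \<noteq> v\<close> by (simp add: segment_convex_hull aff_dim_convex_hull)
  ultimately show ?thesis using F by (simp add: edge_of_def)
qed

subsection \<open>Generic curves of objectives\<close>

text \<open>Two vertices optimal for the same objective lie in the face where it is maximal. If that
  face is not collinear, its vector \<open>e F\<close> is orthogonal to \<open>h\<close>, so
  \<open>s\<close> drops out and \<open>x\<close> lies on a fixed hyperplane. Since there are
  finitely many faces, one null set serves all \<open>s\<close> simultaneously.\<close>

lemma generic_edge:
  fixes P :: "'a::euclidean_space set"
  assumes "polyhedron P"
  obtains Z where "negligible Z"
    "\<And>x s u v. \<lbrakk>x \<notin> Z; u extreme_point_of P; v extreme_point_of P; u \<noteq> v;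
       x + (p + s *\<^sub>R h) \<in> opt_cone P u; x + (p + s *\<^sub>R h) \<in> opt_cone P v\<rbrakk>
       \<Longrightarrow> closed_segment u v edge_of P"
proof -
  define FF where "FF = {F. F face_of P \<and> \<not> collinear F}"
  have "\<forall>F\<in>FF. \<exists>e. e \<noteq> 0 \<and> h \<bullet> e = 0 \<and> (\<forall>y. (\<forall>a\<in>F. \<forall>b\<in>F. y \<bullet> a = y \<bullet> b) \<longrightarrow> y \<bullet> e = 0)"
  proof
    fix F assume "F \<in> FF"
    then have "\<not> collinear F" by (simp add: FF_def)
    from not_collinear_orthogonal[OF this, of h]
    show "\<exists>e. e \<noteq> 0 \<and> h \<bullet> e = 0 \<and> (\<forall>y. (\<forall>a\<in>F. \<forall>b\<in>F. y \<bullet> a = y \<bullet> b) \<longrightarrow> y \<bullet> e = 0)"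
      by metis
  qed
  then obtain e where e: "\<And>F. F \<in> FF \<Longrightarrow> e F \<noteq> 0" "\<And>F. F \<in> FF \<Longrightarrow> h \<bullet> e F = 0"
    "\<And>F y. F \<in> FF \<Longrightarrow> (\<forall>a\<in>F. \<forall>b\<in>F. y \<bullet> a = y \<bullet> b) \<Longrightarrow> y \<bullet> e F = 0"
    by metis
  define Z where "Z = (\<Union>F\<in>FF. {x. e F \<bullet> x = - (e F \<bullet> p)})"
  have "finite FF"
    using finite_polyhedron_faces[OF assms] by (simp add: FF_def)
  then have "negligible Z"
    using e(1) by (auto simp: Z_def intro!: negligible_Union negligible_hyperplane)
  moreover have "closed_segment u v edge_of P"
    if x: "x \<notin> Z" and u: "u extreme_point_of P" and v: "v extreme_point_of P" and "u \<noteq> v"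
      and yu: "x + (p + s *\<^sub>R h) \<in> opt_cone P u" and yv: "x + (p + s *\<^sub>R h) \<in> opt_cone P v" for x s u v
  proof -
    define y where "y = x + (p + s *\<^sub>R h)"
    define F where "F = P \<inter> {z. y \<bullet> z = y \<bullet> u}"
    have "u \<in> P" "v \<in> P" using u v by (auto simp: extreme_point_of_def)
    then have yuv: "y \<bullet> v = y \<bullet> u"
      using yu yv by (auto simp: opt_cone_def y_def intro: antisym)
    have F: "F face_of P"
      unfolding F_def using yu polyhedron_imp_convex[OF assms]
      by (intro face_of_Int_supporting_hyperplane_le) (auto simp: opt_cone_def y_def)
    have "collinear F"
    proof (rule ccontr)
      assume "\<not> collinear F"
      with F have "F \<in> FF" by (simp add: FF_def)
      moreover from this have "y \<bullet> e F = 0"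
        by (rule e(3)) (auto simp: F_def)
      ultimately have "e F \<bullet> x = - (e F \<bullet> p)"
        using e(2)[of F] by (simp add: y_def inner_add_left inner_add_right inner_commute)
      with x \<open>F \<in> FF\<close> show False by (auto simp: Z_def)
    qed
    moreover have "u \<in> F" "v \<in> F"
      using \<open>u \<in> P\<close> \<open>v \<in> P\<close> yuv by (auto simp: F_def)
    ultimately show ?thesis
      using collinear_face_closed_segment[OF F] u v \<open>u \<noteq> v\<close> by blast
  qed
  ultimately show thesis by (rule that)
qed

definition breakpoints :: "'a::euclidean_space set \<Rightarrow> (real \<Rightarrow> 'a) \<Rightarrow> real set" where
  "breakpoints P y = {t \<in> {0..1}. \<exists>u v. u extreme_point_of P \<and> v extreme_point_of P \<and> u \<noteq> v \<and>
     y t \<in> opt_cone P u \<and> y t \<in> opt_cone P v}"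

text \<open>Excluding rational breakpoints makes the optimal vertex unique at all subdivision points
  \<open>k / n\<close>, for every \<open>n\<close> at once.\<close>

definition generic_curve :: "'a::euclidean_space set \<Rightarrow> (real \<Rightarrow> 'a) \<Rightarrow> bool" where
  "generic_curve P y \<longleftrightarrow> finite (breakpoints P y) \<and> breakpoints P y \<inter> \<rat> = {} \<and>
     (\<forall>t u v. u extreme_point_of P \<longrightarrow> v extreme_point_of P \<longrightarrow> u \<noteq> v \<longrightarrow>
        y t \<in> opt_cone P u \<longrightarrow> y t \<in> opt_cone P v \<longrightarrow> closed_segment u v edge_of P)"

lemma opt_cone_Int_orthogonal:
  "y \<in> opt_cone P u \<Longrightarrow> y \<in> opt_cone P v \<Longrightarrow> u \<in> P \<Longrightarrow> v \<in> P \<Longrightarrow> y \<bullet> (u - v) = 0"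
  by (auto simp: opt_cone_def inner_diff_right intro: antisym)

lemma negligible_opt_cone_Int:
  fixes P :: "'a::euclidean_space set"
  assumes "u \<in> P" "v \<in> P" "u \<noteq> v"
  shows "negligible {x. x + c \<in> opt_cone P u \<inter> opt_cone P v}"
proof (rule negligible_subset)
  show "negligible {x. (u - v) \<bullet> x = - ((u - v) \<bullet> c)}"
    using assms by (intro negligible_hyperplane) auto
  show "{x. x + c \<in> opt_cone P u \<inter> opt_cone P v} \<subseteq> {x. (u - v) \<bullet> x = - ((u - v) \<bullet> c)}"
  proof
    fix x assume "x \<in> {x. x + c \<in> opt_cone P u \<inter> opt_cone P v}"
    then have "(x + c) \<bullet> (u - v) = 0"
      using assms opt_cone_Int_orthogonal by blast
    then show "x \<in> {x. (u - v) \<bullet> x = - ((u - v) \<bullet> c)}"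
      by (simp add: inner_add_left inner_commute[of "u - v"] eq_neg_iff_add_eq_0)
  qed
qed

text \<open>Three null sets are avoided: \<open>Z1\<close> for ties that are not edges,
  \<open>Z2\<close> for finiteness, and \<open>Z3\<close>, a countable union, for ties at rational
  parameters.\<close>

lemma generic_curve_almost_everywhere:
  fixes P :: "'a::euclidean_space set"
  assumes "polyhedron P" and inj: "inj_on \<phi> {0..1::real}"
  obtains Z where "negligible Z" "\<And>x. x \<notin> Z \<Longrightarrow> generic_curve P (\<lambda>t. x + (p + \<phi> t *\<^sub>R h))"
proof -
  let ?y = "\<lambda>x t. x + (p + \<phi> t *\<^sub>R h)"
  let ?V = "{v. v extreme_point_of P}"
  define VV where "VV = {(u, v). u \<in> ?V \<and> v \<in> ?V \<and> u \<noteq> v}"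
  have "VV \<subseteq> ?V \<times> ?V" by (auto simp: VV_def)
  then have fin: "finite VV"
    using finite_polyhedron_extreme_points[OF assms(1)] finite_subset by blast
  have VVD: "u \<in> P \<and> v \<in> P \<and> u \<noteq> v" if "(u, v) \<in> VV" for u v
    using that by (auto simp: VV_def extreme_point_of_def)
  obtain Z1 where Z1: "negligible Z1"
    "\<And>x s u v. \<lbrakk>x \<notin> Z1; u extreme_point_of P; v extreme_point_of P; u \<noteq> v;
       x + (p + s *\<^sub>R h) \<in> opt_cone P u; x + (p + s *\<^sub>R h) \<in> opt_cone P v\<rbrakk>
       \<Longrightarrow> closed_segment u v edge_of P"
    using generic_edge[OF assms(1), of p h] by metis
  define Z2 where "Z2 = (\<Union>(u, v)\<in>VV. {x. (u - v) \<bullet> x = - ((u - v) \<bullet> p)})"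
  define Z3 where "Z3 = (\<Union>(t, u, v)\<in>\<rat> \<times> VV. {x. ?y x t \<in> opt_cone P u \<inter> opt_cone P v})"
  have "negligible Z2"
    unfolding Z2_def using fin VVD by (auto intro!: negligible_Union negligible_hyperplane)
  moreover have "negligible Z3"
    unfolding Z3_def
  proof (rule negligible_countable_Union)
    show "countable ((\<lambda>(t, u, v). {x. ?y x t \<in> opt_cone P u \<inter> opt_cone P v}) ` (\<rat> \<times> VV))"
      using fin by (intro countable_image countable_SIGMA countable_rat) (auto intro: countable_finite)
    show "negligible S" if "S \<in> (\<lambda>(t, u, v). {x. ?y x t \<in> opt_cone P u \<inter> opt_cone P v}) ` (\<rat> \<times> VV)" for S
      using that VVD negligible_opt_cone_Int[of _ P] by auto
  qed
  ultimately have "negligible (Z1 \<union> Z2 \<union> Z3)"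
    using Z1(1) by (intro negligible_Un)
  moreover have "generic_curve P (?y x)" if "x \<notin> Z1 \<union> Z2 \<union> Z3" for x
  proof -
    define T where "T = (\<lambda>(u, v). {t\<in>{0..1}. ?y x t \<bullet> (u - v) = 0})"
    have "finite (T a)" if "a \<in> VV" for a
    proof -
      obtain u v where a: "a = (u, v)" by (cases a)
      have *: "s = t" if "s \<in> T a" "t \<in> T a" for s t
      proof -
        have st: "s \<in> {0..1}" "t \<in> {0..1}" and eq: "(x + p) \<bullet> (u - v) + \<phi> s * (h \<bullet> (u - v)) = 0"
          "(x + p) \<bullet> (u - v) + \<phi> t * (h \<bullet> (u - v)) = 0"
          using that by (auto simp: T_def a inner_add_left)
        \<comment> \<open>Outside \<open>Z2\<close> the tie between \<open>u\<close> and
          \<open>v\<close> is a nontrivial affine equation in \<open>\<phi> t\<close>, so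
          injectivity of \<open>\<phi>\<close> leaves at most one breakpoint for each pair.\<close>
        have "h \<bullet> (u - v) \<noteq> 0"
        proof
          assume "h \<bullet> (u - v) = 0"
          with eq have "(u - v) \<bullet> x = - ((u - v) \<bullet> p)"
            by (simp add: inner_add_left inner_commute[of "u - v"] eq_neg_iff_add_eq_0)
          with \<open>x \<notin> Z1 \<union> Z2 \<union> Z3\<close> \<open>a \<in> VV\<close> show False by (auto simp: Z2_def a)
        qed
        with eq have "\<phi> s = \<phi> t" by (metis add_left_cancel mult_right_cancel)
        with inj st show ?thesis by (auto dest: inj_onD)
      qed
      then show ?thesis
        by (metis finite.emptyI finite_insert finite_subset insertI1 subsetI ex_in_conv)
    qed
    moreover have "breakpoints P (?y x) \<subseteq> (\<Union>a\<in>VV. T a)"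
    proof
      fix t assume "t \<in> breakpoints P (?y x)"
      then obtain u v where t: "t \<in> {0..1}" and uv: "(u, v) \<in> VV"
        "?y x t \<in> opt_cone P u" "?y x t \<in> opt_cone P v"
        by (auto simp: breakpoints_def VV_def)
      then have "?y x t \<bullet> (u - v) = 0" using opt_cone_Int_orthogonal VVD by blast
      with t uv show "t \<in> (\<Union>a\<in>VV. T a)" by (auto simp: T_def)
    qed
    ultimately have "finite (breakpoints P (?y x))"
      using fin finite_subset by blast
    moreover have "breakpoints P (?y x) \<inter> \<rat> = {}"
      using that by (auto simp: Z3_def VV_def breakpoints_def)
    ultimately show ?thesis
      unfolding generic_curve_def using Z1(2) that by blast
  qed
  ultimately show thesis by (rule that)
qed

section \<open>Walks in the graph read off from generic curves\<close>

definition skeleton_arcs :: "'a::euclidean_space set \<Rightarrow> ('a \<times> 'a) set" where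
  "skeleton_arcs P = {(u, v). u extreme_point_of P \<and> v extreme_point_of P \<and> closed_segment u v edge_of P}"

definition joined :: "'a::euclidean_space set \<Rightarrow> nat \<Rightarrow> 'a \<Rightarrow> 'a \<Rightarrow> bool" where
  "joined P k u v \<longleftrightarrow> (\<exists>j\<le>k. (u, v) \<in> skeleton_arcs P ^^ j)"

lemma joined_refl: "joined P k u u"
  unfolding joined_def by (intro exI[of _ 0]) auto

lemma joined_trans: "joined P k u v \<Longrightarrow> joined P l v w \<Longrightarrow> joined P (k + l) u w"
  unfolding joined_def by (metis add_mono relcompI relpow_add)

lemma joined_mono: "joined P k u v \<Longrightarrow> k \<le> l \<Longrightarrow> joined P l u v"
  unfolding joined_def using le_trans by blast

lemma joined_arc: "(u, v) \<in> skeleton_arcs P \<Longrightarrow> joined P 1 u v"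
  unfolding joined_def by (intro exI[of _ 1]) auto

lemma joined_sym:
  assumes "joined P k u v" shows "joined P k v u"
proof -
  have "sym (skeleton_arcs P)"
    by (auto simp: sym_def skeleton_arcs_def closed_segment_commute)
  then have "(v, u) \<in> skeleton_arcs P ^^ j" if "(u, v) \<in> skeleton_arcs P ^^ j" for j
    using that by (induction j arbitrary: v) (auto dest: symD intro: relpow_Suc_I2 simp del: relpow.simps(2) elim!: relpow_Suc_E)
  with assms show ?thesis by (auto simp: joined_def)
qed

text \<open>The parameters where \<open>u\<close> is optimal and those where some other vertex is
  optimal form two nonempty closed sets covering \<open>{a..b}\<close>. By connectedness they meet,
  and the common point is a breakpoint.\<close>

lemma breakpoint_between:
  fixes P :: "'a::euclidean_space set"
  assumes fin: "finite {v. v extreme_point_of P}"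
    and y: "continuous_on {a..b} y" and "0 \<le> a" "b \<le> 1" and u: "u extreme_point_of P"
    and cover: "\<And>t. t \<in> {a..b} \<Longrightarrow> \<exists>v. v extreme_point_of P \<and> y t \<in> opt_cone P v"
    and s: "s \<in> {a..b}" "y s \<in> opt_cone P u" and t: "t \<in> {a..b}" "y t \<notin> opt_cone P u"
  shows "\<exists>r\<in>{a..b}. y r \<in> opt_cone P u \<and> r \<in> breakpoints P y"
proof -
  let ?W = "{v. v extreme_point_of P} - {u}"
  define A where "A = {a..b} \<inter> y -` opt_cone P u"
  define B where "B = {a..b} \<inter> y -` (\<Union>v\<in>?W. opt_cone P v)"
  have "closed A"
    unfolding A_def by (intro continuous_closed_preimage y closed_opt_cone) simp
  moreover have "closed B"
    unfolding B_def using fin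
    by (intro continuous_closed_preimage y closed_UN ballI closed_opt_cone) auto
  moreover have "{a..b} \<subseteq> A \<union> B"
    using cover unfolding A_def B_def by blast
  moreover have "A \<inter> {a..b} \<noteq> {}" using s by (auto simp: A_def)
  moreover have "B \<inter> {a..b} \<noteq> {}"
  proof -
    obtain v where "v extreme_point_of P" "y t \<in> opt_cone P v"
      using cover t by blast
    with t have "t \<in> B" by (auto simp: B_def)
    with t show ?thesis by blast
  qed
  moreover have "connected {a..b}" by simp
  ultimately have "A \<inter> B \<inter> {a..b} \<noteq> {}"
    unfolding connected_closed by blast
  then obtain r where "r \<in> A" "r \<in> B" by blast
  then obtain v where r: "r \<in> {a..b}" "y r \<in> opt_cone P u" "v \<in> ?W" "y r \<in> opt_cone P v"
    unfolding A_def B_def by blast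
  then have "r \<in> breakpoints P y"
    using \<open>0 \<le> a\<close> \<open>b \<le> 1\<close> u unfolding breakpoints_def by auto
  with r show ?thesis by blast
qed

text \<open>The curve has a breakpoint in the cone of \<open>u\<close> and another in the cone of
  \<open>v\<close>. As the step contains only one breakpoint, both vertices are optimal there, and
  genericity makes them adjacent.\<close>

lemma short_step:
  fixes P :: "'a::euclidean_space set"
  assumes fin: "finite {v. v extreme_point_of P}" and gen: "generic_curve P y"
    and y: "continuous_on {a..b} y" and ab: "0 \<le> a" "a \<le> b" "b \<le> 1" "a \<in> \<rat>" "b \<in> \<rat>"
    and cover: "\<And>t. t \<in> {a..b} \<Longrightarrow> \<exists>v. v extreme_point_of P \<and> y t \<in> opt_cone P v"
    and one: "\<And>r s. \<lbrakk>r \<in> breakpoints P y; s \<in> breakpoints P y; r \<in> {a..b}; s \<in> {a..b}\<rbrakk> \<Longrightarrow> r = s"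
    and u: "u extreme_point_of P" "y a \<in> opt_cone P u"
    and v: "v extreme_point_of P" "y b \<in> opt_cone P v" and "u \<noteq> v"
  shows "(u, v) \<in> skeleton_arcs P" "y b \<notin> opt_cone P u"
proof -
  have "a \<notin> breakpoints P y" "b \<notin> breakpoints P y"
    using gen ab by (auto simp: generic_curve_def)
  with u v \<open>u \<noteq> v\<close> ab have yv: "y a \<notin> opt_cone P v" and yu: "y b \<notin> opt_cone P u"
    by (auto simp: breakpoints_def)
  from yu show "y b \<notin> opt_cone P u" .
  have "\<exists>r\<in>{a..b}. y r \<in> opt_cone P u \<and> r \<in> breakpoints P y"
    by (rule breakpoint_between[OF fin y ab(1,3) u(1) cover, where s=a and t=b]) (use ab u yu in auto)
  moreover have "\<exists>r\<in>{a..b}. y r \<in> opt_cone P v \<and> r \<in> breakpoints P y"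
    by (rule breakpoint_between[OF fin y ab(1,3) v(1) cover, where s=b and t=a]) (use ab v yv in auto)
  ultimately obtain r where "y r \<in> opt_cone P u" "y r \<in> opt_cone P v"
    using one by blast
  with gen u v \<open>u \<noteq> v\<close> show "(u, v) \<in> skeleton_arcs P"
    by (auto simp: skeleton_arcs_def generic_curve_def)
qed

text \<open>Counting steps instead of breakpoints involves only the two ends of a step. For a
  translated curve the objectives \<open>x\<close> counted at a given step thus form a finite union
  of differences of closed sets, which is measurable.\<close>

definition leaving_steps :: "'a::euclidean_space set \<Rightarrow> (real \<Rightarrow> 'a) \<Rightarrow> nat \<Rightarrow> nat set" where
  "leaving_steps P y n = {k. k < n \<and> (\<exists>v. v extreme_point_of P \<and>
     y (real k / real n) \<in> opt_cone P v \<and> y (real (Suc k) / real n) \<notin> opt_cone P v)}"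

lemma finite_leaving_steps: "finite (leaving_steps P y n)"
  by (simp add: leaving_steps_def)

text \<open>Once the mesh \<open>1 / n\<close> is below the smallest gap between breakpoints, each
  step has at most one of them and advances the walk by at most one edge, and only if it is a
  leaving step.\<close>

lemma generic_curve_joined:
  fixes P :: "'a::euclidean_space set"
  assumes fin: "finite {v. v extreme_point_of P}" and gen: "generic_curve P y"
    and y: "continuous_on {0..1} y"
    and cover: "\<And>t. t \<in> {0..1} \<Longrightarrow> \<exists>v. v extreme_point_of P \<and> y t \<in> opt_cone P v"
    and u: "u extreme_point_of P" "y 0 \<in> opt_cone P u"
    and v: "v extreme_point_of P" "y 1 \<in> opt_cone P v"
  shows "\<forall>\<^sub>F n in sequentially. joined P (card (leaving_steps P y n)) u v"
proof -
  let ?B = "breakpoints P y"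
  have "finite ?B" using gen by (simp add: generic_curve_def)
  \<comment> \<open>The element 1 keeps \<open>D\<close> nonempty when there are fewer than two
    breakpoints.\<close>
  define D where "D = insert 1 ((\<lambda>(r, s). \<bar>r - s\<bar>) ` (?B \<times> ?B - Id))"
  have finD: "finite D" using \<open>finite ?B\<close> by (auto simp: D_def)
  define \<delta> where "\<delta> = Min D"
  have "\<delta> \<in> D" unfolding \<delta>_def using finD by (intro Min_in) (auto simp: D_def)
  then have "0 < \<delta>" by (auto simp: D_def)
  have \<delta>: "r = s" if "r \<in> ?B" "s \<in> ?B" "\<bar>r - s\<bar> < \<delta>" for r s
  proof (rule ccontr)
    assume "r \<noteq> s"
    with that have "\<bar>r - s\<bar> \<in> D" by (force simp: D_def)
    then have "\<delta> \<le> \<bar>r - s\<bar>" unfolding \<delta>_def using finD by simp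
    with that show False by simp
  qed
  have ev: "\<forall>\<^sub>F n in sequentially. 1 / real n < \<delta> \<and> 0 < n"
  proof -
    have "\<forall>\<^sub>F n in sequentially. 1 / real n < \<delta>"
      using lim_1_over_n \<open>0 < \<delta>\<close> by (rule order_tendstoD)
    then show ?thesis using eventually_gt_at_top[of "0::nat"] by eventually_elim simp
  qed
  have "joined P (card (leaving_steps P y n)) u v" if n: "1 / real n < \<delta>" "0 < n" for n
  proof -
    let ?L = "\<lambda>k. leaving_steps P y n \<inter> {..<k}"
    \<comment> \<open>Invariant: any vertex optimal at \<open>k / n\<close> is reached with at most
      one edge for each leaving step among the first \<open>k\<close>.\<close>
    have "joined P (card (?L k)) u x"
      if "k \<le> n" "x extreme_point_of P" "y (real k / real n) \<in> opt_cone P x" for k x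
      using that(1,2,3)
    proof (induction k arbitrary: x)
      case 0
      have "0 \<notin> ?B" using gen by (auto simp: generic_curve_def)
      then have "u = x" using 0 u by (auto simp: breakpoints_def)
      then show ?case by (simp add: joined_refl)
    next
      case (Suc k)
      define a where "a = real k / real n"
      define b where "b = real (Suc k) / real n"
      have ab: "0 \<le> a" "a \<le> b" "b \<le> 1" "a \<in> \<rat>" "b \<in> \<rat>"
        using Suc.prems(1) n by (auto simp: a_def b_def intro!: divide_right_mono)
      have bma: "b - a = 1 / real n"
        by (simp add: a_def b_def flip: diff_divide_distrib)
      obtain w where w: "w extreme_point_of P" "y a \<in> opt_cone P w"
        using cover[of a] ab by force
      have IH: "joined P (card (?L k)) u w"
        by (rule Suc.IH) (use Suc.prems(1) w in \<open>auto simp: a_def\<close>)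
      have Lsub: "?L k \<subseteq> ?L (Suc k)" by auto
      have fL: "finite (?L j)" for j by (simp add: finite_leaving_steps)
      show ?case
      proof (cases "w = x")
        case True
        then show ?thesis using joined_mono[OF IH card_mono[OF fL Lsub]] by simp
      next
        case False
        have one: "r = s" if "r \<in> ?B" "s \<in> ?B" "r \<in> {a..b}" "s \<in> {a..b}" for r s
        proof (rule \<delta>[OF that(1,2)])
          have "\<bar>r - s\<bar> \<le> b - a" using that(3,4) by (simp add: abs_le_iff)
          with bma n(1) show "\<bar>r - s\<bar> < \<delta>" by linarith
        qed
        have cont: "continuous_on {a..b} y"
          by (rule continuous_on_subset[OF y]) (use ab in auto)
        have xb: "x extreme_point_of P" "y b \<in> opt_cone P x"
          using Suc.prems(2,3) by (simp_all add: b_def)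
        have cover': "\<exists>v. v extreme_point_of P \<and> y t \<in> opt_cone P v" if "t \<in> {a..b}" for t
          using cover[of t] that ab by simp
        note step = short_step[OF fin gen cont ab cover' one w xb False]
        have "k \<in> leaving_steps P y n"
          using w step(2) Suc.prems(1) unfolding leaving_steps_def a_def b_def
          by (blast intro: Suc_le_lessD)
        then have "insert k (?L k) \<subseteq> ?L (Suc k)" by auto
        then have "card (insert k (?L k)) \<le> card (?L (Suc k))"
          by (rule card_mono[OF fL])
        then have "card (?L k) + 1 \<le> card (?L (Suc k))"
          using fL by simp
        from joined_mono[OF joined_trans[OF IH joined_arc[OF step(1)]] this]
        show ?thesis .
      qed
    qed
    note walk = this
    have "joined P (card (?L n)) u v"
    proof (rule walk)
      have "real n / real n = 1" using n(2) by simp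
      with v show "y (real n / real n) \<in> opt_cone P v" by (simp only:)
    qed (use v in simp_all)
    moreover have "?L n = leaving_steps P y n" unfolding leaving_steps_def by blast
    ultimately show ?thesis by (simp only:)
  qed
  then show ?thesis
    using ev by (auto elim: eventually_mono)
qed

subsection \<open>The volume of objectives that change cones\<close>

text \<open>The inequalities enter from here on only through \<open>attained\<close>;
  \<open>w v\<close> is a chosen centre of a wide ball in the cone of \<open>v\<close>.\<close>

locale wide_normal_fan =
  fixes P :: "'a::euclidean_space set" and \<tau> :: real and w :: "'a \<Rightarrow> 'a"
  assumes polyhedron_P: "polyhedron P"
    and tau_pos: "0 < \<tau>"
    and norm_w: "v extreme_point_of P \<Longrightarrow> norm (w v) = 1"
    and cball_w: "v extreme_point_of P \<Longrightarrow> cball (w v) \<tau> \<subseteq> opt_cone P v"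
    and attained: "bdd_above ((\<bullet>) y ` P) \<Longrightarrow> \<exists>v. v extreme_point_of P \<and> y \<in> opt_cone P v"
begin

section \<open>The cone of bounded objectives and its sectors\<close>

abbreviation V :: "'a set" where "V \<equiv> {v. v extreme_point_of P}"

lemma finite_V: "finite V"
  by (rule finite_polyhedron_extreme_points[OF polyhedron_P])

definition bounded_objectives :: "'a set" where
  "bounded_objectives = (\<Union>v\<in>V. opt_cone P v)"

lemma bounded_objectivesI: "v \<in> V \<Longrightarrow> y \<in> opt_cone P v \<Longrightarrow> y \<in> bounded_objectives"
  by (auto simp: bounded_objectives_def)

text \<open>The summands may belong to cones of different vertices, so a cone containing the sum is
  not at hand. The sum is however bounded on \<open>P\<close> by
  \<open>y \<bullet> u + z \<bullet> v\<close>, and \<open>attained\<close> supplies an optimal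
  vertex.\<close>

lemma bounded_objectives_add:
  assumes "y \<in> bounded_objectives" "z \<in> bounded_objectives"
  shows "y + z \<in> bounded_objectives"
proof -
  obtain u v where "u \<in> V" "v \<in> V" "y \<in> opt_cone P u" "z \<in> opt_cone P v"
    using assms by (auto simp: bounded_objectives_def)
  then have "(y + z) \<bullet> x \<le> y \<bullet> u + z \<bullet> v" if "x \<in> P" for x
    using that by (auto simp: opt_cone_def inner_add_left intro!: add_mono)
  then have "bdd_above ((\<bullet>) (y + z) ` P)" by (auto simp: bdd_above_def)
  then show ?thesis using attained by (auto simp: bounded_objectives_def)
qed

lemma bounded_objectives_scaleR:
  "y \<in> bounded_objectives \<Longrightarrow> 0 \<le> t \<Longrightarrow> t *\<^sub>R y \<in> bounded_objectives"
  by (auto simp: bounded_objectives_def opt_cone_scaleR)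

lemma closed_bounded_objectives: "closed bounded_objectives"
  unfolding bounded_objectives_def using finite_V closed_opt_cone by (intro closed_UN) auto

lemma w_in_opt_cone: "v \<in> V \<Longrightarrow> w v \<in> opt_cone P v"
  using cball_w[of v] tau_pos by auto

text \<open>The wide ball scaled by \<open>s\<close> has centre \<open>s *\<^sub>R w v\<close> and
  radius \<open>s * \<tau>\<close>, and a cone is closed under scaling.\<close>

lemma w_perturbed:
  assumes "v \<in> V" "0 \<le> s" "norm z \<le> s * \<tau>"
  shows "s *\<^sub>R w v + z \<in> opt_cone P v"
proof (cases "s = 0")
  case True
  with assms show ?thesis by (simp add: opt_cone_def)
next
  case False
  then have "0 < s" using assms by simp
  then have "norm (inverse s *\<^sub>R z) \<le> \<tau>"
    using assms(3) by (simp add: field_simps)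
  then have "w v + inverse s *\<^sub>R z \<in> cball (w v) \<tau>"
    by (simp add: dist_norm)
  with cball_w assms have "w v + inverse s *\<^sub>R z \<in> opt_cone P v" by blast
  from opt_cone_scaleR[OF this assms(2)] \<open>0 < s\<close> show ?thesis
    by (simp add: scaleR_add_right)
qed

definition sector :: "real \<Rightarrow> 'a set" where
  "sector r = bounded_objectives \<inter> cball 0 r"

lemma compact_sector: "compact (sector r)"
  unfolding sector_def by (intro closed_Int_compact closed_bounded_objectives compact_cball)

lemma sector_lmeasurable: "sector r \<in> lmeasurable"
  by (rule lmeasurable_compact[OF compact_sector])

lemma sector_mono: "r \<le> s \<Longrightarrow> sector r \<subseteq> sector s"
  by (auto simp: sector_def)

lemma measure_sector:
  assumes "0 < r"
  shows "measure lebesgue (sector r) = r ^ DIM('a) * measure lebesgue (sector 1)"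
proof -
  have "sector r = (\<lambda>x. r *\<^sub>R x + 0) ` sector 1"
  proof
    show "(\<lambda>x. r *\<^sub>R x + 0) ` sector 1 \<subseteq> sector r"
      using assms by (auto simp: sector_def bounded_objectives_scaleR mult_left_le)
    show "sector r \<subseteq> (\<lambda>x. r *\<^sub>R x + 0) ` sector 1"
    proof
      fix x assume x: "x \<in> sector r"
      have "inverse r *\<^sub>R x \<in> sector 1"
        using x assms by (auto simp: sector_def bounded_objectives_scaleR field_simps)
      moreover have "x = r *\<^sub>R (inverse r *\<^sub>R x) + 0" using assms by simp
      ultimately show "x \<in> (\<lambda>x. r *\<^sub>R x + 0) ` sector 1" by blast
    qed
  qed
  then show ?thesis
    using measure_lebesgue_affine[of r 0 "sector 1"] assms by simp
qed

lemma measure_sector_pos: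
  assumes "v \<in> V"
  shows "0 < measure lebesgue (sector 1)"
proof -
  \<comment> \<open>With this factor the scaled wide ball just fits into the unit ball, as
    \<open>\<rho> + \<rho> * \<tau> = 1\<close>.\<close>
  define \<rho> where "\<rho> = inverse (1 + \<tau>)"
  have \<rho>: "0 < \<rho>" "\<rho> * (1 + \<tau>) = 1" using tau_pos by (auto simp: \<rho>_def)
  have "cball (\<rho> *\<^sub>R w v) (\<rho> * \<tau>) \<subseteq> sector 1"
  proof
    fix x assume "x \<in> cball (\<rho> *\<^sub>R w v) (\<rho> * \<tau>)"
    then have n: "norm (x - \<rho> *\<^sub>R w v) \<le> \<rho> * \<tau>"
      by (simp add: dist_norm norm_minus_commute)
    from w_perturbed[OF assms _ this] \<rho> have "x \<in> opt_cone P v" by simp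
    moreover have "norm x \<le> 1"
      using norm_triangle_ineq[of "x - \<rho> *\<^sub>R w v" "\<rho> *\<^sub>R w v"] n norm_w[of v] assms \<rho>
      by (simp add: algebra_simps)
    ultimately show "x \<in> sector 1"
      using assms by (auto simp: sector_def bounded_objectives_def)
  qed
  then have "measure lebesgue (cball (\<rho> *\<^sub>R w v) (\<rho> * \<tau>)) \<le> measure lebesgue (sector 1)"
    by (rule measure_mono_fmeasurable[OF _ _ sector_lmeasurable]) simp
  moreover have "0 < measure lebesgue (cball (\<rho> *\<^sub>R w v) (\<rho> * \<tau>))"
    using \<rho> tau_pos by (simp add: content_cball_pos)
  ultimately show ?thesis by linarith
qed

text \<open>Translation by \<open>s *\<^sub>R w v\<close> preserves volume and turns every objective in the cone of \<open>v\<close> into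
  one that stays in this cone, so the volume of those that leave is at most what the cone gains when
  the unit ball is enlarged to radius \<open>1 + s\<close>. These gains add up to at most the growth of the whole
  sector, because distinct cones overlap in a null set.\<close>

lemma leaving_set:
  assumes s: "0 \<le> s"
    and step: "\<And>v x. v \<in> V \<Longrightarrow> x \<in> sector 1 \<Longrightarrow> x + g \<in> opt_cone P v \<Longrightarrow> x + g' + s *\<^sub>R w v \<in> opt_cone P v"
  defines "D \<equiv> {x \<in> sector 1. \<exists>v\<in>V. x + g \<in> opt_cone P v \<and> x + g' \<notin> opt_cone P v}"
  shows "D \<in> lmeasurable"
    and "measure lebesgue D \<le> ((1 + s) ^ DIM('a) - 1) * measure lebesgue (sector 1)"
proof -
  let ?\<mu> = "measure lebesgue"
  define C where "C v = {x. x + g \<in> opt_cone P v}" for v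
  define C' where "C' v = {x. x + g' \<in> opt_cone P v}" for v
  have "closed {x. x + c \<in> opt_cone P v}" for c v
  proof -
    have "{x. x + c \<in> opt_cone P v} = (\<lambda>x. x + c) -` opt_cone P v" by auto
    moreover have "closed ((\<lambda>x. x + c) -` opt_cone P v)"
      by (intro closed_vimage closed_opt_cone continuous_intros)
    ultimately show ?thesis by simp
  qed
  then have closed_C: "closed (C v)" "closed (C' v)" for v
    by (simp_all add: C_def C'_def)
  have meas: "C v \<inter> sector r \<in> lmeasurable" "C v \<inter> C' v \<inter> sector r \<in> lmeasurable" for v r
    by (intro lmeasurable_compact closed_Int_compact closed_Int closed_C compact_sector)+
  define Dv where "Dv v = C v \<inter> sector 1 - C v \<inter> C' v \<inter> sector 1" for v
  define E where "E v = C v \<inter> sector (1 + s) - C v \<inter> sector 1" for v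
  have Dv: "Dv v \<in> lmeasurable" for v unfolding Dv_def by (intro fmeasurable.Diff meas)
  have E: "E v \<in> lmeasurable" for v unfolding E_def by (intro fmeasurable.Diff meas)
  have D_eq: "D = (\<Union>v\<in>V. Dv v)" by (auto simp: D_def Dv_def C_def C'_def)
  then show "D \<in> lmeasurable" using Dv finite_V by auto
  have DE: "?\<mu> (Dv v) \<le> ?\<mu> (E v)" if v: "v \<in> V" for v
  proof -
    have "(+) (s *\<^sub>R w v) ` (C v \<inter> sector 1) \<subseteq> C v \<inter> C' v \<inter> sector (1 + s)"
    proof (rule image_subsetI)
      fix x assume x: "x \<in> C v \<inter> sector 1"
      have sw: "s *\<^sub>R w v \<in> opt_cone P v"
        by (rule opt_cone_scaleR[OF w_in_opt_cone[OF v] s])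
      have "norm (s *\<^sub>R w v + x) \<le> 1 + s"
        using norm_triangle_ineq[of "s *\<^sub>R w v" x] x norm_w[of v] v s by (simp add: sector_def)
      moreover have "s *\<^sub>R w v + x \<in> bounded_objectives"
        using x by (intro bounded_objectives_add bounded_objectivesI[OF v sw]) (simp add: sector_def)
      moreover have "s *\<^sub>R w v + (x + g) \<in> opt_cone P v"
        using x by (intro opt_cone_add[OF sw]) (simp add: C_def)
      moreover have "x + g' + s *\<^sub>R w v \<in> opt_cone P v"
        using x by (intro step v) (auto simp: C_def)
      ultimately show "s *\<^sub>R w v + x \<in> C v \<inter> C' v \<inter> sector (1 + s)"
        by (simp add: C_def C'_def sector_def add_ac)
    qed
    then have "?\<mu> ((+) (s *\<^sub>R w v) ` (C v \<inter> sector 1)) \<le> ?\<mu> (C v \<inter> C' v \<inter> sector (1 + s))"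
      by (rule measure_mono_fmeasurable) (auto intro: meas measurable_translation fmeasurableD)
    then have "?\<mu> (C v \<inter> sector 1) \<le> ?\<mu> (C v \<inter> C' v \<inter> sector (1 + s))"
      by (simp add: measure_translation)
    \<comment> \<open>Enlarging the radius adds to \<open>C v \<inter> C' v\<close> only points of
      \<open>E v\<close>. Cancelling the part inside the unit sector leaves the comparison of
      \<open>Dv v\<close> with \<open>E v\<close>.\<close>
    also have "\<dots> \<le> ?\<mu> ((C v \<inter> C' v \<inter> sector 1) \<union> E v)"
      by (rule measure_mono_fmeasurable)
        (auto simp: E_def intro!: fmeasurableD meas fmeasurable.Un fmeasurable.Diff)
    also have "\<dots> \<le> ?\<mu> (C v \<inter> C' v \<inter> sector 1) + ?\<mu> (E v)"
      by (intro measure_Un_le fmeasurableD meas E)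
    finally have "?\<mu> (C v \<inter> sector 1) \<le> ?\<mu> (C v \<inter> C' v \<inter> sector 1) + ?\<mu> (E v)" .
    moreover have "?\<mu> (Dv v) = ?\<mu> (C v \<inter> sector 1) - ?\<mu> (C v \<inter> C' v \<inter> sector 1)"
      unfolding Dv_def by (intro measurable_measure_Diff meas fmeasurableD) auto
    ultimately show ?thesis by simp
  qed
  have "?\<mu> D \<le> (\<Sum>v\<in>V. ?\<mu> (Dv v))"
    unfolding D_eq by (intro measure_UNION_le finite_V fmeasurableD Dv)
  also have "\<dots> \<le> (\<Sum>v\<in>V. ?\<mu> (E v))"
    by (intro sum_mono DE)
  also have "\<dots> = ?\<mu> (\<Union>v\<in>V. E v)"
  proof (rule measure_negligible_finite_Union_image[symmetric, OF finite_V E])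
    show "pairwise (\<lambda>u v. negligible (E u \<inter> E v)) V"
    proof (rule pairwiseI)
      fix u v assume "u \<in> V" "v \<in> V" "u \<noteq> v"
      then have "negligible {x. x + g \<in> opt_cone P u \<inter> opt_cone P v}"
        by (intro negligible_opt_cone_Int) (auto simp: extreme_point_of_def)
      then show "negligible (E u \<inter> E v)"
        by (rule negligible_subset) (auto simp: E_def C_def)
    qed
  qed
  also have "\<dots> \<le> ?\<mu> (sector (1 + s) - sector 1)"
  proof (rule measure_mono_fmeasurable)
    show "(\<Union>v\<in>V. E v) \<subseteq> sector (1 + s) - sector 1" by (auto simp: E_def)
    show "(\<Union>v\<in>V. E v) \<in> sets lebesgue"
      by (intro sets.finite_UN finite_V fmeasurableD E)
    show "sector (1 + s) - sector 1 \<in> lmeasurable"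
      by (intro fmeasurable.Diff sector_lmeasurable)
  qed
  also have "\<dots> = ?\<mu> (sector (1 + s)) - ?\<mu> (sector 1)"
    by (intro measurable_measure_Diff sector_lmeasurable fmeasurableD sector_mono) (use s in simp)
  also have "\<dots> = ((1 + s) ^ DIM('a) - 1) * ?\<mu> (sector 1)"
    using measure_sector[of "1 + s"] s by (simp add: algebra_simps)
  finally show "?\<mu> D \<le> ((1 + s) ^ DIM('a) - 1) * ?\<mu> (sector 1)" .
qed

text \<open>The count is the sum of the indicators of the \<open>n\<close> leaving sets, so its
  integral is the sum of their measures. Each is bounded by \<open>leaving_set\<close> with
  \<open>s = \<sigma> / (n * \<tau>)\<close>, and the total no longer depends on
  \<open>n\<close>.\<close>

lemma nn_integral_leaving_steps:
  assumes n: "0 < n" and \<sigma>: "0 \<le> \<sigma>" and small: "real DIM('a) * \<sigma> / (real n * \<tau>) \<le> 1"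
    and step: "\<And>k v x. k < n \<Longrightarrow> v \<in> V \<Longrightarrow> x \<in> sector 1 \<Longrightarrow> x + \<gamma> (real k / real n) \<in> opt_cone P v \<Longrightarrow>
      x + \<gamma> (real (Suc k) / real n) + (\<sigma> / (real n * \<tau>)) *\<^sub>R w v \<in> opt_cone P v"
  defines "f \<equiv> \<lambda>x. of_nat (card (leaving_steps P (\<lambda>t. x + \<gamma> t) n)) * indicator (sector 1) x"
  shows "f \<in> borel_measurable lebesgue"
    and "(\<integral>\<^sup>+x. f x \<partial>lebesgue) \<le> ennreal (2 * real DIM('a) * \<sigma> / \<tau> * measure lebesgue (sector 1))"
proof -
  define s where "s = \<sigma> / (real n * \<tau>)"
  have s: "0 \<le> s" using \<sigma> tau_pos by (simp add: s_def)
  define D where "D k = {x \<in> sector 1. \<exists>v\<in>V. x + \<gamma> (real k / real n) \<in> opt_cone P v \<and>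
    x + \<gamma> (real (Suc k) / real n) \<notin> opt_cone P v}" for k
  have D: "D k \<in> lmeasurable"
    "measure lebesgue (D k) \<le> ((1 + s) ^ DIM('a) - 1) * measure lebesgue (sector 1)" if "k < n" for k
    unfolding D_def by (rule leaving_set[OF s step[OF that, folded s_def]]; assumption)+
  have f_eq: "f x = (\<Sum>k<n. indicator (D k) x)" for x
  proof (cases "x \<in> sector 1")
    case True
    have "leaving_steps P (\<lambda>t. x + \<gamma> t) n = {k \<in> {..<n}. x \<in> D k}"
      unfolding leaving_steps_def D_def using True by blast
    then have "f x = of_nat (card {k \<in> {..<n}. x \<in> D k})"
      using True by (simp add: f_def)
    also have "{k \<in> {..<n}. x \<in> D k} = {..<n} \<inter> {k. x \<in> D k}" by auto
    also have "of_nat (card ({..<n} \<inter> {k. x \<in> D k})) = (\<Sum>k<n. indicator (D k) x :: ennreal)"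
      by (simp add: indicator_def sum.If_cases)
    finally show ?thesis .
  next
    case False
    then have "x \<notin> D k" for k unfolding D_def by blast
    with False show ?thesis by (simp add: f_def)
  qed
  show "f \<in> borel_measurable lebesgue"
    unfolding f_eq by (intro borel_measurable_sum borel_measurable_indicator fmeasurableD D) simp
  \<comment> \<open>With \<open>z = DIM('a) * s\<close> at most 1, the power is at most
    \<open>exp z\<close>, which is at most \<open>1 + z + z\<^sup>2\<close> and so at most
    \<open>1 + 2 * z\<close>.\<close>
  have "(1 + s) ^ DIM('a) - 1 \<le> 2 * (real DIM('a) * s)"
  proof -
    have 1: "real DIM('a) * s \<le> 1" using small by (simp add: s_def)
    have 0: "0 \<le> real DIM('a) * s" using s by simp
    note exp_bound[OF 0 1]
    moreover have "(real DIM('a) * s)\<^sup>2 \<le> real DIM('a) * s"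
      unfolding power2_eq_square using 0 1 by (intro mult_left_le)
    moreover have "(1 + s) ^ DIM('a) \<le> exp (real DIM('a) * s)"
      unfolding exp_of_nat_mult using s by (intro power_mono) auto
    ultimately show ?thesis by linarith
  qed
  then have bound: "real n * ((1 + s) ^ DIM('a) - 1) \<le> 2 * real DIM('a) * \<sigma> / \<tau>"
  proof -
    assume "(1 + s) ^ DIM('a) - 1 \<le> 2 * (real DIM('a) * s)"
    then have "real n * ((1 + s) ^ DIM('a) - 1) \<le> real n * (2 * (real DIM('a) * s))"
      by (intro mult_left_mono) auto
    also have "\<dots> = 2 * real DIM('a) * \<sigma> / \<tau>"
      using n by (simp add: s_def)
    finally show ?thesis .
  qed
  have "(\<integral>\<^sup>+x. f x \<partial>lebesgue) = (\<Sum>k<n. emeasure lebesgue (D k))"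
    unfolding f_eq
  proof (subst nn_integral_sum)
    show "indicator (D k) \<in> borel_measurable lebesgue" if "k \<in> {..<n}" for k
      using that by (intro borel_measurable_indicator fmeasurableD D) simp
    show "(\<Sum>k<n. \<integral>\<^sup>+x. indicator (D k) x \<partial>lebesgue) = (\<Sum>k<n. emeasure lebesgue (D k))"
      by (intro sum.cong refl nn_integral_indicator fmeasurableD D) simp
  qed
  also have "\<dots> = (\<Sum>k<n. ennreal (measure lebesgue (D k)))"
    by (intro sum.cong refl emeasure_eq_measure2 D) simp
  also have "\<dots> = ennreal (\<Sum>k<n. measure lebesgue (D k))"
    by (simp add: sum_ennreal)
  also have "\<dots> \<le> ennreal (real n * ((1 + s) ^ DIM('a) - 1) * measure lebesgue (sector 1))"
    using sum_bounded_above[of "{..<n}" "\<lambda>k. measure lebesgue (D k)"] D(2)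
    by (intro ennreal_leI) (simp add: mult.assoc)
  also have "\<dots> \<le> ennreal (2 * real DIM('a) * \<sigma> / \<tau> * measure lebesgue (sector 1))"
    by (intro ennreal_leI mult_right_mono bound) simp
  finally show "(\<integral>\<^sup>+x. f x \<partial>lebesgue) \<le> ennreal (2 * real DIM('a) * \<sigma> / \<tau> * measure lebesgue (sector 1))" .
qed

text \<open>The new objective is \<open>a *\<^sub>R (x + g)\<close>, still in the cone, plus
  \<open>s *\<^sub>R w v\<close> and the error \<open>(1 - a) *\<^sub>R x + h\<close>. As
  \<open>x\<close> is in the unit ball, the error is short enough for \<open>w_perturbed\<close>,
  however long \<open>g\<close> is.\<close>

lemma step_in_opt_cone:
  assumes v: "v \<in> V" and x: "x \<in> sector 1" "x + g \<in> opt_cone P v"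
    and a: "0 \<le> a" and s: "0 \<le> s" "\<bar>1 - a\<bar> + norm h \<le> s * \<tau>"
  shows "x + (a *\<^sub>R g + h) + s *\<^sub>R w v \<in> opt_cone P v"
proof -
  have "norm ((1 - a) *\<^sub>R x + h) \<le> \<bar>1 - a\<bar> * norm x + norm h"
    using norm_triangle_ineq[of "(1 - a) *\<^sub>R x" h] by simp
  also have "\<dots> \<le> \<bar>1 - a\<bar> * 1 + norm h"
    using x(1) by (intro add_right_mono mult_left_mono) (auto simp: sector_def)
  finally have "norm ((1 - a) *\<^sub>R x + h) \<le> s * \<tau>" using s(2) by simp
  from opt_cone_add[OF opt_cone_scaleR[OF x(2) a] w_perturbed[OF v s(1) this]]
  show ?thesis by (simp add: algebra_simps)
qed

text \<open>Here \<open>\<sigma>\<close> acts as the length of the curve: a step of duration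
  \<open>1 / n\<close> must be compensated by a translation of size
  \<open>\<sigma> / (n * \<tau>)\<close>. Asking this only for large \<open>n\<close> leaves room
  for the estimate of \<open>exp\<close> on radial curves.\<close>

definition slow_curve :: "real \<Rightarrow> (real \<Rightarrow> 'a) \<Rightarrow> bool" where
  "slow_curve \<sigma> \<gamma> \<longleftrightarrow> (\<forall>\<^sub>F n in sequentially. \<forall>k<n. \<forall>v\<in>V. \<forall>x\<in>sector 1.
     x + \<gamma> (real k / real n) \<in> opt_cone P v \<longrightarrow>
     x + \<gamma> (real (Suc k) / real n) + (\<sigma> / (real n * \<tau>)) *\<^sub>R w v \<in> opt_cone P v)"

text \<open>A step multiplies \<open>g\<close> by \<open>exp l\<close> with
  \<open>l = L / n\<close>. Rescaling the whole objective by this factor leaves only the error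
  \<open>(1 - exp l) *\<^sub>R x\<close>, of norm at most \<open>2 * l\<close>, so the cost is
  logarithmic in the growth of the curve. The summand 0 gives the curve the form used in
  \<open>generic_curve_almost_everywhere\<close>.\<close>

lemma slow_curve_radial:
  assumes L: "0 < L"
  shows "slow_curve (2 * L) (\<lambda>t. 0 + exp (L * t) *\<^sub>R g)"
  unfolding slow_curve_def
proof (rule eventually_mono[OF eventually_gt_at_top[of "nat \<lceil>L\<rceil>"]], intro allI impI ballI)
  fix n k v x
  assume "nat \<lceil>L\<rceil> < n" and v: "v \<in> V" and x: "x \<in> sector 1"
    "x + (0 + exp (L * (real k / real n)) *\<^sub>R g) \<in> opt_cone P v"
  then have n: "L \<le> real n" "0 < real n" by linarith+
  define l where "l = L / real n"
  have l: "0 \<le> l" "l \<le> 1" using n L by (simp_all add: l_def)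
  then have "exp l \<le> 1 + l + l\<^sup>2" by (rule exp_bound)
  moreover have "l\<^sup>2 \<le> l" unfolding power2_eq_square using l by (intro mult_left_le)
  moreover have "1 \<le> exp l" using l by simp
  moreover have "2 * L / (real n * \<tau>) * \<tau> = 2 * l" using tau_pos by (simp add: l_def)
  ultimately have "\<bar>1 - exp l\<bar> + norm (0::'a) \<le> 2 * L / (real n * \<tau>) * \<tau>" by simp
  moreover have "0 \<le> 2 * L / (real n * \<tau>)" using L tau_pos by simp
  ultimately have "x + (exp l *\<^sub>R (0 + exp (L * (real k / real n)) *\<^sub>R g) + 0) + (2 * L / (real n * \<tau>)) *\<^sub>R w v
      \<in> opt_cone P v"
    by (intro step_in_opt_cone v x) simp_all
  moreover have "exp (L * (real (Suc k) / real n)) = exp l * exp (L * (real k / real n))"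
    by (simp add: l_def add_divide_distrib distrib_left flip: exp_add)
  ultimately show "x + (0 + exp (L * (real (Suc k) / real n)) *\<^sub>R g) + (2 * L / (real n * \<tau>)) *\<^sub>R w v
      \<in> opt_cone P v"
    by (simp only: scaleR_scaleR add_0_left add_0_right)
qed

lemma slow_curve_linear:
  assumes "norm h \<le> \<sigma>"
  shows "slow_curve \<sigma> (\<lambda>t. p + t *\<^sub>R h)"
  unfolding slow_curve_def
proof (rule eventually_mono[OF eventually_gt_at_top[of 0]], intro allI impI ballI)
  fix n k v x
  assume "0 < (n::nat)" and v: "v \<in> V" and x: "x \<in> sector 1" "x + (p + (real k / real n) *\<^sub>R h) \<in> opt_cone P v"
  have "\<sigma> / (real n * \<tau>) * \<tau> = \<sigma> / real n" using tau_pos by simp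
  then have "\<bar>1 - 1\<bar> + norm ((1 / real n) *\<^sub>R h) \<le> \<sigma> / (real n * \<tau>) * \<tau>"
    using assms \<open>0 < n\<close> by (simp add: divide_right_mono)
  moreover have "0 \<le> \<sigma>" using assms norm_ge_zero order_trans by blast
  then have "0 \<le> \<sigma> / (real n * \<tau>)" using tau_pos by simp
  ultimately have "x + (1 *\<^sub>R (p + (real k / real n) *\<^sub>R h) + (1 / real n) *\<^sub>R h) + (\<sigma> / (real n * \<tau>)) *\<^sub>R w v
      \<in> opt_cone P v"
    by (intro step_in_opt_cone v x) simp_all
  moreover have "real (Suc k) / real n = real k / real n + 1 / real n"
    by (simp add: add_divide_distrib)
  ultimately show "x + (p + (real (Suc k) / real n) *\<^sub>R h) + (\<sigma> / (real n * \<tau>)) *\<^sub>R w v \<in> opt_cone P v"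
    by (simp only: scaleR_add_left scaleR_one add.assoc)
qed

section \<open>Averaging over the three pieces of the curve\<close>

definition step_count :: "(real \<Rightarrow> 'a) \<Rightarrow> nat \<Rightarrow> 'a \<Rightarrow> nat" where
  "step_count \<gamma> n x = card (leaving_steps P (\<lambda>t. x + \<gamma> t) n)"

lemma slow_curve_integral:
  assumes "slow_curve \<sigma> \<gamma>" "0 \<le> \<sigma>"
  shows "\<forall>\<^sub>F n in sequentially.
    (\<lambda>x. of_nat (step_count \<gamma> n x) * indicator (sector 1) x :: ennreal) \<in> borel_measurable lebesgue \<and>
    (\<integral>\<^sup>+x. of_nat (step_count \<gamma> n x) * indicator (sector 1) x \<partial>lebesgue)
      \<le> ennreal (2 * real DIM('a) * \<sigma> / \<tau> * measure lebesgue (sector 1))"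
proof -
  have "\<forall>\<^sub>F n in sequentially. real DIM('a) * \<sigma> / (real n * \<tau>) \<le> 1"
  proof (rule eventually_mono[OF eventually_gt_at_top[of "nat \<lceil>real DIM('a) * \<sigma> / \<tau>\<rceil>"]])
    fix n assume "nat \<lceil>real DIM('a) * \<sigma> / \<tau>\<rceil> < n"
    then have n: "real DIM('a) * \<sigma> / \<tau> \<le> real n" "0 < real n" by linarith+
    then have "real DIM('a) * \<sigma> \<le> real n * \<tau>" using tau_pos by (simp add: pos_divide_le_eq)
    then show "real DIM('a) * \<sigma> / (real n * \<tau>) \<le> 1" using n(2) tau_pos by (simp add: divide_le_eq_1)
  qed
  with assms(1)[unfolded slow_curve_def] eventually_gt_at_top[of "0::nat"]
  show ?thesis
  proof eventually_elim
    case (elim n)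
    have step: "x + \<gamma> (real (Suc k) / real n) + (\<sigma> / (real n * \<tau>)) *\<^sub>R w v \<in> opt_cone P v"
      if "k < n" "v \<in> V" "x \<in> sector 1" "x + \<gamma> (real k / real n) \<in> opt_cone P v" for k v x
      using elim(1) that by blast
    from nn_integral_leaving_steps[where \<gamma> = \<gamma>, OF elim(2) assms(2) elim(3) step]
    show ?case unfolding step_count_def by blast
  qed
qed

lemma generic_curve_step_count:
  assumes "generic_curve P (\<lambda>t. x + \<gamma> t)" "continuous_on {0..1} \<gamma>" "x \<in> sector 1"
    and "\<And>t. t \<in> {0..1} \<Longrightarrow> \<gamma> t \<in> bounded_objectives"
    and "u \<in> V" "x + \<gamma> 0 \<in> opt_cone P u" "v \<in> V" "x + \<gamma> 1 \<in> opt_cone P v"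
  shows "\<forall>\<^sub>F n in sequentially. joined P (step_count \<gamma> n x) u v"
  unfolding step_count_def
proof (rule generic_curve_joined[OF finite_V assms(1)])
  show "continuous_on {0..1} (\<lambda>t. x + \<gamma> t)"
    by (intro continuous_intros assms(2))
  show "\<exists>v. v extreme_point_of P \<and> x + \<gamma> t \<in> opt_cone P v" if "t \<in> {0..1}" for t
    using bounded_objectives_add[of x "\<gamma> t"] assms(3) assms(4)[OF that]
    by (auto simp: sector_def bounded_objectives_def)
qed (use assms in auto)

text \<open>If every walk from \<open>u\<close> to \<open>v\<close> had more than \<open>B\<close>
  edges, the total count would eventually be at least the integer \<open>K > B\<close> for almost
  every \<open>x\<close> in the sector. Fatou's lemma then contradicts the bound
  \<open>B * ?\<mu>\<close> on its integrals.\<close>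

lemma joined_bound:
  assumes u: "u \<in> V" and v: "v \<in> V" and L: "0 < L" "1 \<le> exp L * \<tau>"
  shows "joined P (nat \<lfloor>4 * real DIM('a) * (2 * L + 1) / \<tau>\<rfloor>) u v"
proof (rule ccontr)
  let ?S = "sector 1"
  let ?\<mu> = "measure lebesgue (sector 1)"
  define B where "B = 4 * real DIM('a) * (2 * L + 1) / \<tau>"
  define K where "K = Suc (nat \<lfloor>B\<rfloor>)"
  have K: "B < real K" unfolding K_def by linarith
  assume "\<not> joined P (nat \<lfloor>4 * real DIM('a) * (2 * L + 1) / \<tau>\<rfloor>) u v"
  then have not_joined: "K \<le> k" if "joined P k u v" for k
    using that joined_mono[of P k u v "nat \<lfloor>B\<rfloor>"] by (force simp: K_def B_def[symmetric] not_le Suc_le_eq)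
  \<comment> \<open>The first piece is parametrised outwards, so the walk it yields leads to
    \<open>u\<close> and is reversed by \<open>joined_sym\<close>.\<close>
  define \<gamma>1 where "\<gamma>1 = (\<lambda>t::real. 0 + exp (L * t) *\<^sub>R w u)"
  define \<gamma>2 where "\<gamma>2 = (\<lambda>t::real. w u + t *\<^sub>R (w v - w u))"
  define \<gamma>3 where "\<gamma>3 = (\<lambda>t::real. 0 + exp (L * t) *\<^sub>R w v)"
  have w: "w u \<in> bounded_objectives" "w v \<in> bounded_objectives"
    using u v w_in_opt_cone by (auto intro: bounded_objectivesI)
  have inj: "inj_on (\<lambda>t. exp (L * t)) {0..1}" using L by (auto simp: inj_on_def)
  obtain Z1 where Z1: "negligible Z1" "\<And>x. x \<notin> Z1 \<Longrightarrow> generic_curve P (\<lambda>t. x + \<gamma>1 t)"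
    unfolding \<gamma>1_def using generic_curve_almost_everywhere[OF polyhedron_P inj, of 0 "w u"] by metis
  obtain Z2 where Z2: "negligible Z2" "\<And>x. x \<notin> Z2 \<Longrightarrow> generic_curve P (\<lambda>t. x + \<gamma>2 t)"
    unfolding \<gamma>2_def
    using generic_curve_almost_everywhere[OF polyhedron_P inj_on_id2, of "w u" "w v - w u"] by metis
  obtain Z3 where Z3: "negligible Z3" "\<And>x. x \<notin> Z3 \<Longrightarrow> generic_curve P (\<lambda>t. x + \<gamma>3 t)"
    unfolding \<gamma>3_def using generic_curve_almost_everywhere[OF polyhedron_P inj, of 0 "w v"] by metis
  define c where "c n x = step_count \<gamma>1 n x + step_count \<gamma>2 n x + step_count \<gamma>3 n x" for n x
  have far: "\<forall>\<^sub>F n in sequentially. K \<le> c n x" if x: "x \<in> ?S" "x \<notin> Z1 \<union> Z2 \<union> Z3" for x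
  proof -
    have gen: "generic_curve P (\<lambda>t. x + \<gamma>1 t)" "generic_curve P (\<lambda>t. x + \<gamma>2 t)" "generic_curve P (\<lambda>t. x + \<gamma>3 t)"
      using x Z1 Z2 Z3 by auto
    have "x + w u \<in> bounded_objectives" "x + w v \<in> bounded_objectives"
      using x w by (auto simp: sector_def intro: bounded_objectives_add)
    then obtain a b where a: "a \<in> V" "x + w u \<in> opt_cone P a" and b: "b \<in> V" "x + w v \<in> opt_cone P b"
      by (auto simp: bounded_objectives_def)
    \<comment> \<open>At the far ends the scaled wide ball has radius at least 1 and absorbs any
      \<open>x\<close> of the sector.\<close>
    have "norm x \<le> exp L * \<tau>" using x L by (auto simp: sector_def)
    then have far_end: "x + exp L *\<^sub>R w u \<in> opt_cone P u" "x + exp L *\<^sub>R w v \<in> opt_cone P v"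
      using w_perturbed[of _ "exp L" x] u v by (simp_all add: add.commute)
    have "\<forall>\<^sub>F n in sequentially. joined P (step_count \<gamma>1 n x) a u"
      by (rule generic_curve_step_count[OF gen(1) _ x(1)])
        (use a u far_end w in \<open>auto simp: \<gamma>1_def intro!: continuous_intros bounded_objectives_scaleR\<close>)
    moreover have "\<gamma>2 t \<in> bounded_objectives" if "t \<in> {0..1}" for t
    proof -
      have "\<gamma>2 t = (1 - t) *\<^sub>R w u + t *\<^sub>R w v" by (simp add: \<gamma>2_def algebra_simps)
      then show ?thesis
        using that w by (auto intro!: bounded_objectives_add bounded_objectives_scaleR)
    qed
    then have "\<forall>\<^sub>F n in sequentially. joined P (step_count \<gamma>2 n x) a b"
      by (intro generic_curve_step_count[OF gen(2) _ x(1)])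
        (use a b in \<open>auto simp: \<gamma>2_def intro!: continuous_intros\<close>)
    moreover have "\<forall>\<^sub>F n in sequentially. joined P (step_count \<gamma>3 n x) b v"
      by (rule generic_curve_step_count[OF gen(3) _ x(1)])
        (use b v far_end w in \<open>auto simp: \<gamma>3_def intro!: continuous_intros bounded_objectives_scaleR\<close>)
    ultimately show ?thesis
    proof eventually_elim
      case (elim n)
      have "joined P (c n x) u v"
        unfolding c_def by (rule joined_trans[OF joined_trans[OF joined_sym[OF elim(1)] elim(2)] elim(3)])
      then show ?case by (rule not_joined)
    qed
  qed
  define f where "f n x = (of_nat (c n x) * indicator ?S x :: ennreal)" for n x
  have "norm (w v - w u) \<le> 2"
    using norm_triangle_ineq4[of "w v" "w u"] norm_w u v by simp
  then have slow: "slow_curve (2 * L) \<gamma>1" "slow_curve 2 \<gamma>2" "slow_curve (2 * L) \<gamma>3"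
    unfolding \<gamma>1_def \<gamma>2_def \<gamma>3_def by (intro slow_curve_radial slow_curve_linear L(1); assumption)+
  have L0: "0 \<le> 2 * L" using L by simp
  have "\<forall>\<^sub>F n in sequentially. f n \<in> borel_measurable lebesgue \<and>
      (\<integral>\<^sup>+x. f n x \<partial>lebesgue) \<le> ennreal (B * ?\<mu>)"
    using slow_curve_integral[OF slow(1) L0] slow_curve_integral[OF slow(2) zero_le_numeral]
      slow_curve_integral[OF slow(3) L0]
  proof eventually_elim
    case (elim n)
    let ?f = "\<lambda>\<gamma> x. of_nat (step_count \<gamma> n x) * indicator ?S x :: ennreal"
    have m: "?f \<gamma>1 \<in> borel_measurable lebesgue" "?f \<gamma>2 \<in> borel_measurable lebesgue"
      "?f \<gamma>3 \<in> borel_measurable lebesgue"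
      using elim L by simp_all
    have nonneg: "0 \<le> 2 * real DIM('a) * (2 * L) / \<tau> * ?\<mu>" "0 \<le> 2 * real DIM('a) * 2 / \<tau> * ?\<mu>"
      using L tau_pos by simp_all
    have f_eq: "f n = (\<lambda>x. ?f \<gamma>1 x + ?f \<gamma>2 x + ?f \<gamma>3 x)"
      by (simp add: fun_eq_iff f_def c_def distrib_right)
    have "(\<integral>\<^sup>+x. f n x \<partial>lebesgue)
      = (\<integral>\<^sup>+x. ?f \<gamma>1 x \<partial>lebesgue) + (\<integral>\<^sup>+x. ?f \<gamma>2 x \<partial>lebesgue) + (\<integral>\<^sup>+x. ?f \<gamma>3 x \<partial>lebesgue)"
      unfolding f_eq using m by (simp add: nn_integral_add)
    also have "\<dots> \<le> ennreal (2 * real DIM('a) * (2 * L) / \<tau> * ?\<mu>) + ennreal (2 * real DIM('a) * 2 / \<tau> * ?\<mu>)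
        + ennreal (2 * real DIM('a) * (2 * L) / \<tau> * ?\<mu>)"
      using elim L by (intro add_mono) simp_all
    also have "\<dots> = ennreal (2 * real DIM('a) * (2 * L) / \<tau> * ?\<mu> + 2 * real DIM('a) * 2 / \<tau> * ?\<mu>
        + 2 * real DIM('a) * (2 * L) / \<tau> * ?\<mu>)"
      using nonneg by (simp only: ennreal_plus add_nonneg_nonneg)
    \<comment> \<open>The pieces have lengths \<open>2 * L\<close>, 2 and \<open>2 * L\<close>, each
      weighted by \<open>2 * DIM('a) / \<tau>\<close>.\<close>
    also have "2 * real DIM('a) * (2 * L) / \<tau> * ?\<mu> + 2 * real DIM('a) * 2 / \<tau> * ?\<mu>
        + 2 * real DIM('a) * (2 * L) / \<tau> * ?\<mu> = B * ?\<mu>"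
      using tau_pos by (simp add: B_def field_simps)
    finally have "(\<integral>\<^sup>+x. f n x \<partial>lebesgue) \<le> ennreal (B * ?\<mu>)" .
    moreover have "f n \<in> borel_measurable lebesgue"
      unfolding f_eq using m by (intro borel_measurable_add)
    ultimately show ?case by blast
  qed
  then obtain n0 where n0: "\<And>n. n0 \<le> n \<Longrightarrow> f n \<in> borel_measurable lebesgue"
    "\<And>n. n0 \<le> n \<Longrightarrow> (\<integral>\<^sup>+x. f n x \<partial>lebesgue) \<le> ennreal (B * ?\<mu>)"
    unfolding eventually_sequentially by blast
  \<comment> \<open>Measurability and the bound are established from \<open>n0\<close> on, while
    Fatou's lemma is applied to a sequence with both at every index.\<close>
  define F where "F n = f (n + n0)" for n
  have "ennreal (real K * ?\<mu>) = (\<integral>\<^sup>+x. of_nat K * indicator ?S x \<partial>lebesgue)"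
    using sector_lmeasurable[of 1]
    by (simp add: nn_integral_cmult_indicator fmeasurableD emeasure_eq_measure2 ennreal_mult ennreal_of_nat_eq_real_of_nat)
  also have "\<dots> \<le> (\<integral>\<^sup>+x. liminf (\<lambda>n. F n x) \<partial>lebesgue)"
  proof (rule nn_integral_mono_AE)
    have "AE x in lebesgue. x \<notin> Z1 \<union> Z2 \<union> Z3"
      using Z1(1) Z2(1) Z3(1) by (intro AE_not_in) (auto simp: negligible_iff_null_sets[symmetric] intro!: negligible_Un)
    then show "AE x in lebesgue. of_nat K * indicator ?S x \<le> liminf (\<lambda>n. F n x)"
    proof eventually_elim
      case (elim x)
      show ?case
      proof (cases "x \<in> ?S")
        case True
        have "\<forall>\<^sub>F n in sequentially. K \<le> c (n + n0) x"
          using far[OF True elim] by (rule sequentially_offset)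
        then have "\<forall>\<^sub>F n in sequentially. of_nat K \<le> F n x"
          by eventually_elim (simp add: F_def f_def True)
        then show ?thesis using True by (simp add: Liminf_bounded)
      qed simp
    qed
  qed
  also have "\<dots> \<le> liminf (\<lambda>n. \<integral>\<^sup>+x. F n x \<partial>lebesgue)"
    by (rule nn_integral_liminf) (simp add: F_def n0)
  also have "\<dots> \<le> limsup (\<lambda>n. \<integral>\<^sup>+x. F n x \<partial>lebesgue)"
    by (rule Liminf_le_Limsup) simp
  also have "\<dots> \<le> ennreal (B * ?\<mu>)"
    by (rule Limsup_bounded) (simp add: F_def n0)
  finally have "ennreal (real K * ?\<mu>) \<le> ennreal (B * ?\<mu>)" .
  moreover have pos: "0 < ?\<mu>" by (rule measure_sector_pos[OF u])
  moreover have "0 \<le> B" using L tau_pos by (simp add: B_def)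
  ultimately have "real K * ?\<mu> \<le> B * ?\<mu>" by (subst (asm) ennreal_le_iff) simp_all
  with K pos show False by simp
qed

end

subsection \<open>The graph\<close>

lemma skeleton_arcs_relpow_imp_awalk:
  assumes "(u, v) \<in> skeleton_arcs P ^^ j" "u extreme_point_of P"
  shows "\<exists>p. pre_digraph.awalk (skeleton P) u p v \<and> length p = j"
  using assms
proof (induction j arbitrary: u)
  case 0
  interpret wf_digraph "skeleton P" by (rule wf_digraph_skeleton)
  from 0 have "u = v" "u \<in> verts (skeleton P)" by (simp_all add: skeleton_def)
  then have "awalk u [] v" by (simp add: awalk_Nil_iff)
  then show ?case by (intro exI[of _ "[]"]) simp
next
  case (Suc j)
  interpret wf_digraph "skeleton P" by (rule wf_digraph_skeleton)
  obtain x where x: "(u, x) \<in> skeleton_arcs P" "(x, v) \<in> skeleton_arcs P ^^ j"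
    using Suc.prems(1) by (rule relpow_Suc_E2)
  then obtain p where p: "awalk x p v" "length p = j"
    using Suc.IH[of x] by (auto simp: skeleton_arcs_def)
  have "(u, x) \<in> arcs (skeleton P)" "tail (skeleton P) (u, x) = u" "head (skeleton P) (u, x) = x"
    using x(1) by (simp_all add: skeleton_def skeleton_arcs_def)
  with p(1) have "awalk u ((u, x) # p) v"
    by (simp add: awalk_Cons_iff)
  with p(2) show ?case by (intro exI[of _ "(u, x) # p"]) simp
qed

text \<open>With unit weights no cycle has negative cost, so cutting cycles out of a walk does not
  lengthen it.\<close>

lemma joined_imp_apath:
  assumes "joined P k u v" "u extreme_point_of P"
  shows "\<exists>p. pre_digraph.apath (skeleton P) u p v \<and> length p \<le> k"
proof -
  interpret wf_digraph "skeleton P" by (rule wf_digraph_skeleton)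
  have cost: "awalk_cost (\<lambda>_. 1) p = real (length p)" for p :: "('a \<times> 'a) list"
    by (induction p) auto
  obtain p where p: "awalk u p v" "length p \<le> k"
    using assms skeleton_arcs_relpow_imp_awalk unfolding joined_def by blast
  have "awalk_cost (\<lambda>_. 1) (awalk_to_apath p) \<le> awalk_cost (\<lambda>_. 1) p"
    by (rule awalk_to_path_no_neg_cyc_cost[OF p(1)]) (auto simp: cost)
  with p apath_awalk_to_apath[OF p(1)] show ?thesis
    by (intro exI[of _ "awalk_to_apath p"]) (auto simp: cost)
qed

text \<open>A ball of radius above 1 about a unit vector is a neighbourhood of the origin, so the
  cone of \<open>u\<close> would be the whole space. It would contain \<open>x - u\<close> for each
  \<open>x\<close> in \<open>P\<close>, which forces \<open>x = u\<close>. The bound on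
  \<open>\<tau>\<close> makes \<open>ln (1 / \<tau>)\<close> nonnegative.\<close>

lemma (in wide_normal_fan) tau_le_1:
  assumes u: "u extreme_point_of P" and dim: "0 < aff_dim P"
  shows "\<tau> \<le> 1"
proof (rule ccontr)
  assume "\<not> \<tau> \<le> 1"
  have "P \<subseteq> {u}"
  proof
    fix x assume x: "x \<in> P"
    \<comment> \<open>Solves \<open>norm (x - u) + s = s * \<tau>\<close>, so that the scaled ball
      reaches \<open>x - u\<close>.\<close>
    define s where "s = norm (x - u) / (\<tau> - 1)"
    have s: "0 \<le> s" "s * (\<tau> - 1) = norm (x - u)"
      using \<open>\<not> \<tau> \<le> 1\<close> by (auto simp: s_def)
    have "norm ((x - u) - s *\<^sub>R w u) \<le> norm (x - u) + s"
      using norm_triangle_ineq4[of "x - u" "s *\<^sub>R w u"] norm_w[OF u] s(1) by simp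
    also have "\<dots> = s * \<tau>" using s(2) by (simp add: algebra_simps)
    finally have "s *\<^sub>R w u + ((x - u) - s *\<^sub>R w u) \<in> opt_cone P u"
      using u s(1) by (intro w_perturbed) auto
    with x have "(x - u) \<bullet> (x - u) \<le> 0"
      by (simp add: opt_cone_def inner_diff_right)
    then show "x \<in> {u}" using inner_gt_zero_iff[of "x - u"] by (simp add: not_less[symmetric])
  qed
  then have "aff_dim P \<le> aff_dim {u}" by (rule aff_dim_subset)
  with dim show False by simp
qed

theorem theorem10:
  fixes A :: "real^'n^'m" and b :: "real^'m" and \<tau> :: real and P :: "(real^'n) set"
  assumes "\<tau> > 0"
    and "P = polyhedron_of A b"
    and "pointed P"
    and "full_dimensional P"
    and "\<And>v. v extreme_point_of P \<Longrightarrow> wide \<tau> (normal_cone A b v)"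
  shows "graph_diameter (skeleton P) \<le> ereal (8 * real CARD('n) / \<tau> * (1 + ln (1 / \<tau>))) \<and>
    (\<forall>u v. u extreme_point_of P \<longrightarrow> v extreme_point_of P \<longrightarrow>
      (\<exists>p. pre_digraph.apath (skeleton P) u p v \<and>
           real (length p) \<le> 8 * real CARD('n) / \<tau> * (1 + ln (1 / \<tau>))))"
proof -
  define B where "B = 8 * real CARD('n) / \<tau> * (1 + ln (1 / \<tau>))"
  have dim: "0 < aff_dim P"
    using assms(4) by (simp add: full_dimensional_def)
  then have "P \<noteq> {}" by auto
  have "\<forall>v. \<exists>c. v extreme_point_of P \<longrightarrow> norm c = 1 \<and> cball c \<tau> \<subseteq> normal_cone A b v"
    using assms(5) unfolding wide_def by (metis mem_sphere_0)
  then obtain w where w: "\<And>v. v extreme_point_of P \<Longrightarrow> norm (w v) = 1"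
    "\<And>v. v extreme_point_of P \<Longrightarrow> cball (w v) \<tau> \<subseteq> normal_cone A b v"
    by metis
  interpret wide_normal_fan P \<tau> w
  proof
    show "polyhedron P" using assms(2) polyhedron_polyhedron_of by simp
    show "0 < \<tau>" by (rule assms(1))
    show "norm (w v) = 1" if "v extreme_point_of P" for v using that by (rule w(1))
    show "cball (w v) \<tau> \<subseteq> opt_cone P v" if "v extreme_point_of P" for v
      using w(2)[OF that] normal_cone_subset_opt_cone[of A b v] assms(2) by simp
    show "\<exists>v. v extreme_point_of P \<and> y \<in> opt_cone P v" if "bdd_above ((\<bullet>) y ` P)" for y
      using bdd_above_imp_opt_cone[of A b y] assms(2,3) \<open>P \<noteq> {}\<close> that by simp
  qed
  have path: "\<exists>p. pre_digraph.apath (skeleton P) u p v \<and> real (length p) \<le> B"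
    if u: "u extreme_point_of P" and v: "v extreme_point_of P" for u v
  proof -
    have "\<tau> \<le> 1" by (rule tau_le_1[OF u dim])
    \<comment> \<open>The summand \<open>1 / 2\<close> keeps the radial curves injective when \<open>\<tau> = 1\<close>.\<close>
    define L where "L = ln (1 / \<tau>) + 1 / 2"
    have "0 \<le> ln (1 / \<tau>)" using assms(1) \<open>\<tau> \<le> 1\<close> by simp
    then have "0 < L" by (simp add: L_def)
    have "exp L * \<tau> = exp (1 / 2)"
      using assms(1) by (simp add: L_def exp_add)
    then have "1 \<le> exp L * \<tau>" by simp
    \<comment> \<open>Here \<open>2 * L + 1 = 2 * (1 + ln (1 / \<tau>))\<close>, which turns the
      factor 4 into 8.\<close>
    moreover have "4 * real DIM(real^'n) * (2 * L + 1) / \<tau> = B"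
      by (simp add: B_def L_def algebra_simps)
    ultimately have "joined P (nat \<lfloor>B\<rfloor>) u v"
      using joined_bound[of u v L] u v \<open>0 < L\<close> by simp
    then obtain p where p: "pre_digraph.apath (skeleton P) u p v" "length p \<le> nat \<lfloor>B\<rfloor>"
      using joined_imp_apath u by blast
    have "0 \<le> B" using assms(1) \<open>0 \<le> ln (1 / \<tau>)\<close> by (simp add: B_def)
    then have "real (nat \<lfloor>B\<rfloor>) \<le> B" by simp
    with p show ?thesis by (intro exI[of _ p]) linarith
  qed
  interpret G: wf_digraph "skeleton P" by (rule wf_digraph_skeleton)
  have cost: "G.awalk_cost (\<lambda>_. 1) p = real (length p)" for p
    by (induction p) auto
  have "G.\<mu> (\<lambda>_. 1) u v \<le> ereal B" if "u extreme_point_of P" "v extreme_point_of P" for u v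
  proof -
    obtain p where p: "G.apath u p v" "real (length p) \<le> B"
      using path[OF \<open>u extreme_point_of P\<close> \<open>v extreme_point_of P\<close>] by blast
    then have "G.\<mu> (\<lambda>_. 1) u v \<le> ereal (G.awalk_cost (\<lambda>_. 1) p)"
      by (intro G.min_cost_le_walk_cost G.awalkI_apath)
    with p(2) show ?thesis unfolding cost by (meson ereal_less_eq(3) order_trans)
  qed
  then have "graph_diameter (skeleton P) \<le> ereal B"
    unfolding graph_diameter_def by (intro SUP_least) (simp add: skeleton_def)
  with path show ?thesis unfolding B_def by blast
qed

end
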